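(* Let $K$ be a commutative ring with identity and $n\ge1$. The operad $\mathit{Schur}$, with $P(q+1)=\mathrm{Schur}(q,n,K)$, acts on $T(V_n)$, $L_K(X_n)$, $\mathrm{Der}^{\triangle}_*(L_K(X_n))$ and $\mathrm{Der}_*(L_K(X_n))$: for every $q$, $f\in\mathrm{Schur}(q,n,K)$ acts on the component $V_n^{\otimes q}$ by evaluation, on $L^q_K(X_n)\subseteq V_n^{\otimes q}$ by restriction, and on $\mathrm{Der}_q(L_K(X_n))$ by $\theta\mapsto\Phi_f(\theta)$, and these make the components left $\mathrm{Schur}(q,n,K)$-modules. Furthermore, let $v_1,\dots,v_n\in\widetilde M_n$ be such that either for every $i$ one has $v_i=\widetilde\chi_{i,j_i}$ for some $j_i\ne i$, or for every $i$ one has $v_i=\widetilde\theta_{i,[x_{s_i},x_{t_i}]}$ for some $s_i<t_i$ with $i,s_i,t_i$ distinct. Then $\mathrm{Der}_*(L_K(X_n))$ is generated by $\{v_1,\dots,v_n\}$, i.e. the smallest Lie subalgebra $S$ of $\mathrm{Der}_*(L_K(X_n))$ containing $v_1,\dots,v_n$ and satisfying $\Phi_f(S\cap \mathrm{Der}_q(L_K(X_n)))\subseteq S$ for all $q\ge2$ and $f\in\mathrm{Schur}(q,n,K)$ is $\mathrm{Der}_*(L_K(X_n))$ itself.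
   Context: $V_n$ is the free $K$-module on $X_n=\{x_1,\dots,x_n\}$, $T(V_n)=\bigoplus_{q\ge0}V_n^{\otimes q}$, and $L_K(X_n)=\bigoplus_{p\ge1}L_K^p(X_n)$ is the free Lie algebra graded by bracket length, regarded as a Lie subalgebra of $T(V_n)$ with $L^q_K(X_n)\subseteq V_n^{\otimes q}$. $\Sigma_q$ acts on $V_n^{\otimes q}$ by $\sigma(y_1\otimes\cdots\otimes y_q)=y_{\sigma^{-1}(1)}\otimes\cdots\otimes y_{\sigma^{-1}(q)}$. $\mathrm{Schur}(q,n,K)$ is the algebra (under composition) of $K$-linear endomorphisms of $V_n^{\otimes q}$ commuting with $\Sigma_q$; $\mathrm{Schur}(0,n,K)=K$. The operad $\mathit{Schur}$ has $P(m)=\mathrm{Schur}(m-1,n,K)$ for $m\ge1$. $\mathrm{Der}_p(L_K(X_n))$ is the set of derivations $\theta$ of $L_K(X_n)$ with $\theta(x_i)\in L_K^p(X_n)$ for all $i$. $\mathrm{Der}^\triangle_*(L_K(X_n))=\bigoplus_{p\ge1}\mathrm{Der}_p(L_K(X_n))$ and $\mathrm{Der}_*(L_K(X_n))=\bigoplus_{p\ge2}\mathrm{Der}_p(L_K(X_n))$, with bracket $[D,D']=DD'-D'D$. For $f\in\mathrm{Schur}(q,n,K)$ and $\theta\in\mathrm{Der}_q(L_K(X_n))$, $\Phi_f(\theta)$ is the unique derivation with $\Phi_f(\theta)(x_i)=f(\theta(x_i))$ for all $i$ (elements of $\mathrm{Schur}(q,n,K)$ map $L^q_K(X_n)$ into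 itself). $\widetilde M_n$ consists of the derivations $\widetilde\chi_{i,j}$ ($i\neq j$) with $\widetilde\chi_{i,j}(x_i)=[x_i,x_j]$, $\widetilde\chi_{i,j}(x_k)=0$ for $k\ne i$, and $\widetilde\theta_{i,[x_s,x_t]}$ ($s<t$, $i\notin\{s,t\}$) with $\widetilde\theta_{i,[x_s,x_t]}(x_i)=[x_s,x_t]$, $\widetilde\theta_{i,[x_s,x_t]}(x_k)=0$ for $k\neq i$. *)

theory Defs
  imports
    "HOL.Hull"
    "HOL-Library.Poly_Mapping"
    "HOL-Library.Function_Algebras"
    "HOL-Combinatorics.Permutations"
    "HOL-Algebra.Module"
begin

text \<open>
  The ground ring is a type \<open>'k\<close> of sort \<open>{comm_ring, comm_monoid_mult}\<close>: a commutative ring with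
  identity, where, unlike in class \<open>comm_ring_1\<close>, the zero ring is allowed.  The generators are
  indexed by a type \<open>'n\<close> of sort \<open>{finite, linorder}\<close>, so that \<open>n = CARD('n) \<ge> 1\<close> is an arbitrary
  positive number.
\<close>

section \<open>The tensor algebra\<close>

text \<open>
  Words under concatenation form the free monoid on \<open>X_n\<close>, written additively because this is what
  the convolution product of \<^theory>\<open>HOL-Library.Poly_Mapping\<close> expects.  The free \<open>K\<close>-module on the
  words, with this product, is \<open>T(V_n)\<close>: the word \<open>[i_1, \<dots>, i_q]\<close> stands for the pure tensor
  of \<open>x_{i_1}, \<dots>, x_{i_q}\<close> (in this order), the product is the tensor product, and the words of
  length \<open>q\<close> form a basis of the \<open>q\<close>-th tensor power of \<open>V_n\<close>.
\<close>

instantiation list :: (type) monoid_add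
begin

definition zero_list :: "'a list" where "0 = []"
definition plus_list :: "'a list \<Rightarrow> 'a list \<Rightarrow> 'a list" where "u + v = u @ v"

instance by standard (simp_all add: zero_list_def plus_list_def)

end

type_synonym ('n, 'k) tensor = "'n list \<Rightarrow>\<^sub>0 'k"

definition gen :: "'n \<Rightarrow> ('n, 'k::{comm_ring, comm_monoid_mult}) tensor" where
  "gen i = Poly_Mapping.single [i] 1"

definition tscale :: "'k \<Rightarrow> ('n, 'k) tensor \<Rightarrow> ('n, 'k::{comm_ring, comm_monoid_mult}) tensor" where
  "tscale c a = Poly_Mapping.map (\<lambda>d. c * d) a"

definition tensor_power :: "nat \<Rightarrow> ('n, 'k::{comm_ring, comm_monoid_mult}) tensor set" where
  "tensor_power q = {a. \<forall>w\<in>Poly_Mapping.keys a. length w = q}"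

text \<open>
  The linear extension of the left action of permutations of \<open>{..<q}\<close> on words of length \<open>q\<close>:
  letter \<open>k\<close> of the new word is letter \<open>\<sigma>\<^sup>-\<^sup>1 k\<close> of the old one.  (The notation \<open>inv\<close> for inverse
  functions is taken over by group inverses here, whence \<open>inv_into UNIV\<close>.)
\<close>

definition perm_act ::
    "(nat \<Rightarrow> nat) \<Rightarrow> ('n, 'k) tensor \<Rightarrow> ('n, 'k::{comm_ring, comm_monoid_mult}) tensor" where
  "perm_act \<sigma> a =
    (\<Sum>w\<in>Poly_Mapping.keys a.
       Poly_Mapping.single (permute_list (inv_into UNIV \<sigma>) w) (Poly_Mapping.lookup a w))"


section \<open>Modules and graded modules\<close>

text \<open>The axioms of the library locale \<open>module\<close>, over a ring that need not be commutative.\<close>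

locale left_module = R?: ring R + M?: abelian_group M
    for R (structure) and M (structure) +
  assumes smult_closed:
      "\<lbrakk>a \<in> carrier R; x \<in> carrier M\<rbrakk> \<Longrightarrow> a \<odot>\<^bsub>M\<^esub> x \<in> carrier M"
    and smult_l_distr:
      "\<lbrakk>a \<in> carrier R; b \<in> carrier R; x \<in> carrier M\<rbrakk> \<Longrightarrow>
        (a \<oplus> b) \<odot>\<^bsub>M\<^esub> x = a \<odot>\<^bsub>M\<^esub> x \<oplus>\<^bsub>M\<^esub> b \<odot>\<^bsub>M\<^esub> x"
    and smult_r_distr:
      "\<lbrakk>a \<in> carrier R; x \<in> carrier M; y \<in> carrier M\<rbrakk> \<Longrightarrow>
        a \<odot>\<^bsub>M\<^esub> (x \<oplus>\<^bsub>M\<^esub> y) = a \<odot>\<^bsub>M\<^esub> x \<oplus>\<^bsub>M\<^esub> a \<odot>\<^bsub>M\<^esub> y"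
    and smult_assoc1:
      "\<lbrakk>a \<in> carrier R; b \<in> carrier R; x \<in> carrier M\<rbrakk> \<Longrightarrow>
        (a \<otimes> b) \<odot>\<^bsub>M\<^esub> x = a \<odot>\<^bsub>M\<^esub> (b \<odot>\<^bsub>M\<^esub> x)"
    and smult_one:
      "x \<in> carrier M \<Longrightarrow> \<one> \<odot>\<^bsub>M\<^esub> x = x"

text \<open>
  A set of elements of an additive group, with a given scalar action, as a module record.  The
  multiplicative fields of the record play no role in a module.
\<close>

definition module_on :: "'m::ab_group_add set \<Rightarrow> ('r \<Rightarrow> 'm \<Rightarrow> 'm) \<Rightarrow> ('r, 'm) module" where
  "module_on A act =
    \<lparr>carrier = A, mult = undefined, one = undefined, zero = 0, add = (+), smult = act\<rparr>"

definition sum_of_components :: "nat set \<Rightarrow> (nat \<Rightarrow> 'm::ab_group_add set) \<Rightarrow> 'm set" where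
  "sum_of_components I C =
    {\<Sum>q\<in>F. a q | F a. finite F \<and> F \<subseteq> I \<and> (\<forall>q\<in>F. a q \<in> C q)}"

definition is_internal_direct_sum ::
    "'m::ab_group_add set \<Rightarrow> nat set \<Rightarrow> (nat \<Rightarrow> 'm set) \<Rightarrow> bool" where
  "is_internal_direct_sum A I C \<longleftrightarrow>
    A = sum_of_components I C \<and>
    (\<forall>F a. finite F \<and> F \<subseteq> I \<and> (\<forall>q\<in>F. a q \<in> C q) \<and> (\<Sum>q\<in>F. a q) = 0 \<longrightarrow>
      (\<forall>q\<in>F. a q = 0))"


section \<open>The Schur algebras and the Schur operad\<close>

text \<open>
  An endomorphism of the \<open>q\<close>-th tensor power is encoded as a function on the whole tensor algebra
  that vanishes outside the tensor power.  With this convention, equality, addition and composition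
  of endomorphisms are those of functions; the identity has to be cut off accordingly.
\<close>

definition schur_carrier ::
    "nat \<Rightarrow> (('n, 'k::{comm_ring, comm_monoid_mult}) tensor \<Rightarrow> ('n, 'k) tensor) set" where
  "schur_carrier q =
    {f. (\<forall>a\<in>tensor_power q. f a \<in> tensor_power q) \<and>
        (\<forall>a. a \<notin> tensor_power q \<longrightarrow> f a = 0) \<and>
        (\<forall>a\<in>tensor_power q. \<forall>b\<in>tensor_power q. f (a + b) = f a + f b) \<and>
        (\<forall>c. \<forall>a\<in>tensor_power q. f (tscale c a) = tscale c (f a)) \<and>
        (\<forall>\<sigma>. \<sigma> permutes {..<q} \<longrightarrow>
          (\<forall>a\<in>tensor_power q. f (perm_act \<sigma> a) = perm_act \<sigma> (f a)))}"

definition Schur ::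
    "nat \<Rightarrow> (('n, 'k::{comm_ring, comm_monoid_mult}) tensor \<Rightarrow> ('n, 'k) tensor) ring" where
  "Schur q =
    \<lparr>carrier = schur_carrier q,
     mult = (\<lambda>f g. f \<circ> g),
     one = (\<lambda>a. if a \<in> tensor_power q then a else 0),
     zero = (\<lambda>_. 0),
     add = (\<lambda>f g a. f a + g a)\<rparr>"

text \<open>
  Only the arities \<open>m \<ge> 1\<close> are meaningful.  In arity 1, \<open>Schur 0\<close> consists of the linear
  endomorphisms of the free module of rank one on the empty word, that is, of the scalars.
\<close>

definition schur_operad ::
    "nat \<Rightarrow> (('n, 'k::{comm_ring, comm_monoid_mult}) tensor \<Rightarrow> ('n, 'k) tensor) ring" where
  "schur_operad m = Schur (m - 1)"

text \<open>
  The operad acts on \<open>A\<close>, the direct sum of its components \<open>C q\<close> for \<open>q \<in> I\<close>: each \<open>C q\<close> is a left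
  module over the algebra in arity \<open>q + 1\<close>, and the module structure is compatible with
  multiplication by scalars from \<open>K\<close>, given on \<open>A\<close> by \<open>sc\<close>.
\<close>

definition schur_operad_acts_on ::
    "'m::ab_group_add set \<Rightarrow> nat set \<Rightarrow> (nat \<Rightarrow> 'm set) \<Rightarrow>
     ('k::{comm_ring, comm_monoid_mult} \<Rightarrow> 'm \<Rightarrow> 'm) \<Rightarrow>
     ((('n, 'k) tensor \<Rightarrow> ('n, 'k) tensor) \<Rightarrow> 'm \<Rightarrow> 'm) \<Rightarrow> bool" where
  "schur_operad_acts_on A I C sc act \<longleftrightarrow>
    is_internal_direct_sum A I C \<and>
    (\<forall>q\<in>I.
      left_module (schur_operad (q + 1)) (module_on (C q) act) \<and>
      (\<forall>c. \<forall>f\<in>carrier (schur_operad (q + 1)).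
        (\<lambda>a. tscale c (f a)) \<in> carrier (schur_operad (q + 1)) \<and>
        (\<forall>x\<in>C q. act (\<lambda>a. tscale c (f a)) x = sc c (act f x))))"


section \<open>The free Lie algebra\<close>

definition commutator ::
    "('n, 'k) tensor \<Rightarrow> ('n, 'k) tensor \<Rightarrow> ('n, 'k::{comm_ring, comm_monoid_mult}) tensor" where
  "commutator a b = a * b - b * a"

definition lie_subalgebra ::
    "('k \<Rightarrow> 'm \<Rightarrow> 'm) \<Rightarrow> ('m \<Rightarrow> 'm \<Rightarrow> 'm) \<Rightarrow> 'm::ab_group_add set \<Rightarrow> bool" where
  "lie_subalgebra sc br S \<longleftrightarrow>
    0 \<in> S \<and> (\<forall>a\<in>S. \<forall>b\<in>S. a + b \<in> S) \<and> (\<forall>c. \<forall>a\<in>S. sc c a \<in> S) \<and> (\<forall>a\<in>S. \<forall>b\<in>S. br a b \<in> S)"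

text \<open>
  The free Lie algebra on \<open>X_n\<close> in its standard realization: over every commutative ring, the Lie
  subalgebra of the tensor algebra generated by \<open>X_n\<close> is free on \<open>X_n\<close>.
\<close>

definition free_lie :: "('n, 'k::{comm_ring, comm_monoid_mult}) tensor set" where
  "free_lie = lie_subalgebra tscale commutator hull (range gen)"

text \<open>The submodule spanned by the iterated brackets of \<open>p\<close> generators; it is 0 for \<open>p = 0\<close>.\<close>

inductive has_bracket_length ::
    "nat \<Rightarrow> ('n, 'k::{comm_ring, comm_monoid_mult}) tensor \<Rightarrow> bool" where
  gen: "has_bracket_length 1 (gen i)"
| bracket: "has_bracket_length p a \<Longrightarrow> has_bracket_length q b \<Longrightarrow>
    has_bracket_length (p + q) (commutator a b)"
| zero: "has_bracket_length p 0"
| add: "has_bracket_length p a \<Longrightarrow> has_bracket_length p b \<Longrightarrow> has_bracket_length p (a + b)"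
| scale: "has_bracket_length p a \<Longrightarrow> has_bracket_length p (tscale c a)"

definition free_lie_comp :: "nat \<Rightarrow> ('n, 'k::{comm_ring, comm_monoid_mult}) tensor set" where
  "free_lie_comp p = {a. has_bracket_length p a}"


section \<open>Derivations of the free Lie algebra\<close>

text \<open>
  Like endomorphisms of tensor powers, derivations are extended by 0 to the tensor algebra; sums of
  derivations are then pointwise sums of functions.
\<close>

definition is_derivation ::
    "(('n, 'k::{comm_ring, comm_monoid_mult}) tensor \<Rightarrow> ('n, 'k) tensor) \<Rightarrow> bool" where
  "is_derivation D \<longleftrightarrow>
    (\<forall>a\<in>free_lie. D a \<in> free_lie) \<and>
    (\<forall>a. a \<notin> free_lie \<longrightarrow> D a = 0) \<and>
    (\<forall>a\<in>free_lie. \<forall>b\<in>free_lie. D (a + b) = D a + D b) \<and>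
    (\<forall>c. \<forall>a\<in>free_lie. D (tscale c a) = tscale c (D a)) \<and>
    (\<forall>a\<in>free_lie. \<forall>b\<in>free_lie.
      D (commutator a b) = commutator (D a) b + commutator a (D b))"

definition Der ::
    "nat \<Rightarrow> (('n, 'k::{comm_ring, comm_monoid_mult}) tensor \<Rightarrow> ('n, 'k) tensor) set" where
  "Der p = {\<theta>. is_derivation \<theta> \<and> (\<forall>i. \<theta> (gen i) \<in> free_lie_comp p)}"

definition Der_triangle ::
    "(('n, 'k::{comm_ring, comm_monoid_mult}) tensor \<Rightarrow> ('n, 'k) tensor) set" where
  "Der_triangle = sum_of_components {1..} Der"

definition Der_star ::
    "(('n, 'k::{comm_ring, comm_monoid_mult}) tensor \<Rightarrow> ('n, 'k) tensor) set" where
  "Der_star = sum_of_components {2..} Der"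

definition der_scale ::
    "'k::{comm_ring, comm_monoid_mult} \<Rightarrow> (('n, 'k) tensor \<Rightarrow> ('n, 'k) tensor) \<Rightarrow>
     (('n, 'k) tensor \<Rightarrow> ('n, 'k) tensor)" where
  "der_scale c D = (\<lambda>a. tscale c (D a))"

definition der_bracket ::
    "(('n, 'k::{comm_ring, comm_monoid_mult}) tensor \<Rightarrow> ('n, 'k) tensor) \<Rightarrow>
     (('n, 'k) tensor \<Rightarrow> ('n, 'k) tensor) \<Rightarrow> (('n, 'k) tensor \<Rightarrow> ('n, 'k) tensor)" where
  "der_bracket D D' = (\<lambda>a. D (D' a) - D' (D a))"

text \<open>The derivation with prescribed values in the free Lie algebra on the generators.\<close>

definition der_of ::
    "('n \<Rightarrow> ('n, 'k::{comm_ring, comm_monoid_mult}) tensor) \<Rightarrow>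
     (('n, 'k) tensor \<Rightarrow> ('n, 'k) tensor)" where
  "der_of u = (THE D. is_derivation D \<and> (\<forall>i. D (gen i) = u i))"

definition Phi ::
    "(('n, 'k::{comm_ring, comm_monoid_mult}) tensor \<Rightarrow> ('n, 'k) tensor) \<Rightarrow>
     (('n, 'k) tensor \<Rightarrow> ('n, 'k) tensor) \<Rightarrow> (('n, 'k) tensor \<Rightarrow> ('n, 'k) tensor)" where
  "Phi f \<theta> = der_of (\<lambda>i. f (\<theta> (gen i)))"

definition chi ::
    "'n \<Rightarrow> 'n \<Rightarrow> (('n, 'k::{comm_ring, comm_monoid_mult}) tensor \<Rightarrow> ('n, 'k) tensor)" where
  "chi i j = der_of (\<lambda>k. if k = i then commutator (gen i) (gen j) else 0)"

definition theta ::
    "'n \<Rightarrow> 'n \<Rightarrow> 'n \<Rightarrow> (('n, 'k::{comm_ring, comm_monoid_mult}) tensor \<Rightarrow> ('n, 'k) tensor)" where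
  "theta i s t = der_of (\<lambda>k. if k = i then commutator (gen s) (gen t) else 0)"

definition M_tilde ::
    "(('n::linorder, 'k::{comm_ring, comm_monoid_mult}) tensor \<Rightarrow> ('n, 'k) tensor) set" where
  "M_tilde = {chi i j | i j. i \<noteq> j} \<union> {theta i s t | i s t. s < t \<and> i \<notin> {s, t}}"

definition schur_lie_subalgebra ::
    "(('n, 'k::{comm_ring, comm_monoid_mult}) tensor \<Rightarrow> ('n, 'k) tensor) set \<Rightarrow> bool" where
  "schur_lie_subalgebra S \<longleftrightarrow>
    S \<subseteq> Der_star \<and> lie_subalgebra der_scale der_bracket S \<and>
    (\<forall>q\<ge>2. \<forall>f\<in>carrier (Schur q). Phi f ` (S \<inter> Der q) \<subseteq> S)"

end

theory Submission
  imports Defs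
begin

text \<open>
  Since the free Lie algebra is realized inside the tensor algebra, a derivation with prescribed values
  is the restriction of a derivation of the tensor algebra.  The component of degree \<open>q\<close> is spanned by
  left-normed brackets, hence is the image of the tensor power under a combination of place
  permutations.  Elements of the Schur algebra commute with these and so preserve the component.

  For the generation statement, elements of \<open>Schur 2\<close> induced by substitutions of letters carry the
  given derivations to all of \<open>Der 2\<close>.  Then \<open>Der (q + 1)\<close> is obtained from brackets of elements of \<open>Der q\<close>
  and \<open>Der 2\<close>, the unwanted terms being removed by the projections onto weight
  spaces, which belong to the Schur algebra over every ring \<open>K\<close>.
\<close>

section \<open>Linear maps on the tensor algebra\<close>

text \<open>What is used instead is only that they form an image: if \<open>L\<close> is the
  left-normed bracketing, a signed sum of place permutations, then \<open>f (L t) = L (f t)\<close>.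

  In the generation argument the obstacle is that \<open>Phi f\<close> applies one and the same
  \<open>f\<close> to the values at all generators, and never moves a value from one generator to
  another. This is why a starting derivation is given at every generator, and why the two nonzero
  values of a bracket have to be told apart by \<open>f\<close> alone. Their weights, i.e. multisets
  of letters, do this: if \<open>a\<close> has weight \<open>M\<close>, the weights are
  \<open>M\<close> plus \<open>j\<close> at \<open>x_j\<close> and \<open>M\<close> plus
  \<open>i\<close> at \<open>x_i\<close>. They differ whenever \<open>i\<close> and \<open>j\<close>
  do, even if \<open>a\<close> itself contains these letters.\<close>

abbreviation word :: "'n list \<Rightarrow> ('n, 'k::{comm_ring, comm_monoid_mult}) tensor" where
  "word w \<equiv> Poly_Mapping.single w 1"

definition tlinear :: "(('n, 'k) tensor \<Rightarrow> ('m, 'k::{comm_ring, comm_monoid_mult}) tensor) \<Rightarrow> bool" where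
  "tlinear F \<longleftrightarrow> (\<forall>a b. F (a + b) = F a + F b) \<and> (\<forall>c a. F (tscale c a) = tscale c (F a))"

definition tsubmodule :: "('n, 'k::{comm_ring, comm_monoid_mult}) tensor set \<Rightarrow> bool" where
  "tsubmodule N \<longleftrightarrow> 0 \<in> N \<and> (\<forall>a\<in>N. \<forall>b\<in>N. a + b \<in> N) \<and> (\<forall>c. \<forall>a\<in>N. tscale c a \<in> N)"

definition linear_ext ::
    "('n list \<Rightarrow> ('m, 'k) tensor) \<Rightarrow> ('n, 'k::{comm_ring, comm_monoid_mult}) tensor \<Rightarrow> ('m, 'k) tensor" where
  "linear_ext g a = (\<Sum>w\<in>Poly_Mapping.keys a. tscale (Poly_Mapping.lookup a w) (g w))"

lemma lookup_tscale [simp]: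
  fixes a :: "('n, 'k::{comm_ring, comm_monoid_mult}) tensor"
  shows "Poly_Mapping.lookup (tscale c a) w = c * Poly_Mapping.lookup a w"
  unfolding tscale_def by (simp add: Poly_Mapping.map.rep_eq when_def)

lemma tscale_right_distrib: "tscale c (a + b) = tscale c a + tscale c b"
  by (rule poly_mapping_eqI) (simp add: lookup_add distrib_left)

lemma tscale_left_distrib: "tscale (c + d) a = tscale c a + tscale d a"
  by (rule poly_mapping_eqI) (simp add: lookup_add distrib_right)

lemma tscale_tscale: "tscale c (tscale d a) = tscale (c * d) a"
  by (rule poly_mapping_eqI) (simp add: mult.assoc)

lemma tscale_one [simp]: "tscale 1 a = a"
  by (rule poly_mapping_eqI) simp

lemma tscale_zero [simp]: "tscale c 0 = 0"
  by (rule poly_mapping_eqI) simp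

lemma tscale_zero_left [simp]: "tscale 0 a = 0"
  by (rule poly_mapping_eqI) simp

lemma tscale_minus_one: "tscale (- 1) a = - a"
  by (rule poly_mapping_eqI) simp

lemma tscale_diff: "tscale c (a - b) = tscale c a - tscale c b"
  by (rule poly_mapping_eqI) (simp add: lookup_minus right_diff_distrib)

lemma tscale_sum: "tscale c (sum f A) = (\<Sum>x\<in>A. tscale c (f x))"
  by (induction A rule: infinite_finite_induct) (simp_all add: tscale_right_distrib)

lemma tscale_word: "tscale c (word w) = Poly_Mapping.single w c"
  by (rule poly_mapping_eqI) (simp add: lookup_single when_def)

text \<open>Scalars sit in the tensor algebra as multiples of the empty word, so their compatibility
  with products on one side is associativity.\<close>

lemma tscale_eq_mult:
  "tscale c a = Poly_Mapping.single [] c * a"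
  unfolding tscale_def mult_map_scale_conv_mult zero_list_def ..

lemma tscale_mult_left: "tscale c a * b = tscale c (a * b)"
  by (simp add: tscale_eq_mult mult.assoc)

lemma word_expansion:
  "a = (\<Sum>w\<in>Poly_Mapping.keys a. tscale (Poly_Mapping.lookup a w) (word w))"
  by (rule poly_mapping_eqI)
    (simp add: lookup_sum lookup_single when_def if_distrib in_keys_iff sum.If_cases cong: if_cong)

lemma word_mult: "word u * word v = word (u @ v)"
  by (simp add: mult_single plus_list_def)

section \<open>Linear maps and submodules\<close>

lemma tlinearI:
  assumes "\<And>a b. F (a + b) = F a + F b" "\<And>c a. F (tscale c a) = tscale c (F a)"
  shows "tlinear F"
  using assms by (simp add: tlinear_def)

lemma tlinear_add: "tlinear F \<Longrightarrow> F (a + b) = F a + F b"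
  and tlinear_scale: "tlinear F \<Longrightarrow> F (tscale c a) = tscale c (F a)"
  by (simp_all add: tlinear_def)

lemma tlinear_zero: "tlinear F \<Longrightarrow> F 0 = 0"
  using tlinear_scale[of F 0 0] by simp

lemma tlinear_sum: "tlinear F \<Longrightarrow> F (sum f A) = (\<Sum>x\<in>A. F (f x))"
  by (induction A rule: infinite_finite_induct) (simp_all add: tlinear_add tlinear_zero)

lemma tlinear_uminus: "tlinear F \<Longrightarrow> F (- a) = - F a"
  using tlinear_scale[of F "-1" a] by (simp add: tscale_minus_one)

lemma tlinear_diff: "tlinear F \<Longrightarrow> F (a - b) = F a - F b"
  using tlinear_add[of F a "-b"] by (simp add: tlinear_uminus)

lemma tsubmodule_zero: "tsubmodule N \<Longrightarrow> 0 \<in> N"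
  and tsubmodule_add: "tsubmodule N \<Longrightarrow> a \<in> N \<Longrightarrow> b \<in> N \<Longrightarrow> a + b \<in> N"
  and tsubmodule_scale: "tsubmodule N \<Longrightarrow> a \<in> N \<Longrightarrow> tscale c a \<in> N"
  by (simp_all add: tsubmodule_def)

lemma tsubmodule_sum:
  "tsubmodule N \<Longrightarrow> (\<And>x. x \<in> A \<Longrightarrow> f x \<in> N) \<Longrightarrow> sum f A \<in> N"
  by (induction A rule: infinite_finite_induct) (auto simp: tsubmodule_def)

lemma tsubmodule_uminus: "tsubmodule N \<Longrightarrow> a \<in> N \<Longrightarrow> - a \<in> N"
  unfolding tsubmodule_def tscale_minus_one[symmetric] by blast

lemma tsubmodule_diff: "tsubmodule N \<Longrightarrow> a \<in> N \<Longrightarrow> b \<in> N \<Longrightarrow> a - b \<in> N"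
  using tsubmodule_uminus[of N b] by (metis add_uminus_conv_diff tsubmodule_def)

lemma tsubmodule_image:
  assumes F: "tlinear F" and N: "tsubmodule N"
  shows "tsubmodule (F ` N)"
proof -
  have "0 \<in> F ` N"
    by (rule image_eqI[of _ _ 0]) (simp_all add: tlinear_zero F tsubmodule_zero N)
  moreover have "F a + F b \<in> F ` N" if "a \<in> N" "b \<in> N" for a b
    by (rule image_eqI[of _ _ "a + b"]) (simp_all add: tlinear_add F tsubmodule_add N that)
  moreover have "tscale c (F a) \<in> F ` N" if "a \<in> N" for c a
    by (rule image_eqI[of _ _ "tscale c a"]) (simp_all add: tlinear_scale F tsubmodule_scale N that)
  ultimately show ?thesis by (simp add: tsubmodule_def)
qed

text \<open>Only the words that occur in \<open>a\<close> are tested. For homogeneous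
  \<open>a\<close> one may therefore assume that the word has the right length or weight.\<close>

lemma tlinear_span:
  assumes "tlinear F" "tsubmodule N" "\<And>w. w \<in> Poly_Mapping.keys a \<Longrightarrow> F (word w) \<in> N"
  shows "F a \<in> N"
proof -
  have "F a = (\<Sum>w\<in>Poly_Mapping.keys a. tscale (Poly_Mapping.lookup a w) (F (word w)))"
    using arg_cong[OF word_expansion[of a], of F]
    by (simp only: tlinear_sum[OF assms(1)] tlinear_scale[OF assms(1)])
  then show ?thesis
    using assms(2,3) by (auto intro!: tsubmodule_sum simp: tsubmodule_def)
qed

lemma tlinear_eqI:
  fixes F :: "('n, 'k::{comm_ring, comm_monoid_mult}) tensor \<Rightarrow> ('m, 'k) tensor"
  assumes "tlinear F" "tlinear G" "\<And>w. w \<in> Poly_Mapping.keys a \<Longrightarrow> F (word w) = G (word w)"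
  shows "F a = G a"
proof -
  have "tlinear (\<lambda>a. F a - G a)"
    using assms by (intro tlinearI) (simp_all add: tlinear_add tlinear_scale tscale_diff)
  moreover have "tsubmodule {0::('m, 'k) tensor}" by (simp add: tsubmodule_def)
  ultimately have "F a - G a \<in> {0}"
    by (rule tlinear_span) (simp add: assms)
  then show ?thesis by simp
qed

text \<open>Cancellation can make the support of a sum smaller than the union of the supports. Over
  a common finite index set additivity is checked term by term.\<close>

lemma linear_ext_superset:
  assumes "finite A" "Poly_Mapping.keys a \<subseteq> A"
  shows "linear_ext g a = (\<Sum>w\<in>A. tscale (Poly_Mapping.lookup a w) (g w))"
  unfolding linear_ext_def using assms
  by (intro sum.mono_neutral_left) (auto simp: in_keys_iff)

lemma tlinear_linear_ext [simp]:
  fixes g :: "'n list \<Rightarrow> ('m, 'k::{comm_ring, comm_monoid_mult}) tensor"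
  shows "tlinear (linear_ext g)"
proof (rule tlinearI)
  fix a b :: "('n, 'k) tensor" and c
  let ?A = "Poly_Mapping.keys a \<union> Poly_Mapping.keys b"
  show "linear_ext g (a + b) = linear_ext g a + linear_ext g b"
    using keys_add[of a b]
    by (simp add: linear_ext_superset[of ?A] lookup_add tscale_left_distrib sum.distrib)
  have "Poly_Mapping.keys (tscale c a) \<subseteq> Poly_Mapping.keys a"
    by (auto simp: in_keys_iff)
  then show "linear_ext g (tscale c a) = tscale c (linear_ext g a)"
    by (simp add: linear_ext_superset[of "Poly_Mapping.keys a"] tscale_sum tscale_tscale)
qed

lemma linear_ext_word [simp]: "linear_ext g (word w) = g w"
  by (subst linear_ext_superset[of "{w}"]) auto

lemma linear_ext_diff: "linear_ext (\<lambda>w. g w - h w) a = linear_ext g a - linear_ext h a"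
  by (simp add: linear_ext_def tscale_diff sum_subtractf)

lemma tlinear_id: "tlinear (\<lambda>a. a)"
  and tlinear_mult_right: "tlinear F \<Longrightarrow> tlinear (\<lambda>a. F a * b)"
  by (simp_all add: tlinear_def distrib_right tscale_mult_left)

lemma tlinear_compose: "tlinear F \<Longrightarrow> tlinear G \<Longrightarrow> tlinear (\<lambda>a. F (G a))"
  by (simp add: tlinear_def)

lemma tlinear_plus: "tlinear F \<Longrightarrow> tlinear G \<Longrightarrow> tlinear (\<lambda>a. F a + G a)"
  and tlinear_minus: "tlinear F \<Longrightarrow> tlinear G \<Longrightarrow> tlinear (\<lambda>a. F a - G a)"
  by (simp_all add: tlinear_def tscale_right_distrib tscale_diff)

text \<open>Here the scalar has to pass \<open>a\<close>. Both sides are linear in \<open>a\<close>,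
  K being commutative, and a word commutes with multiples of the empty word.\<close>

lemma tscale_mult_right: "a * tscale c b = tscale c (a * b)"
proof -
  have "tlinear (\<lambda>a. a * tscale c b)" "tlinear (\<lambda>a. tscale c (a * b))"
    by (simp_all add: tlinear_def distrib_right tscale_mult_left tscale_right_distrib tscale_tscale mult.commute)
  moreover have "word w * tscale c b = tscale c (word w * b)" for w
    by (simp add: tscale_eq_mult mult_single plus_list_def flip: mult.assoc)
  ultimately show ?thesis by (rule tlinear_eqI)
qed

lemma tlinear_mult_left: "tlinear F \<Longrightarrow> tlinear (\<lambda>a. b * F a)"
  by (simp add: tlinear_def distrib_left tscale_mult_right)

lemma tlinear_commutator_left: "tlinear F \<Longrightarrow> tlinear (\<lambda>a. commutator (F a) b)"
  and tlinear_commutator_right: "tlinear F \<Longrightarrow> tlinear (\<lambda>a. commutator b (F a))"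
  unfolding commutator_def by (intro tlinear_minus tlinear_mult_left tlinear_mult_right; assumption)+

lemma commutator_zero [simp]: "commutator 0 b = 0" "commutator a 0 = 0"
  by (simp_all add: commutator_def)

text \<open>This form of the Jacobi identity trades a bracket in the right argument for brackets in
  the left one, the direction in which left-normed brackets are nested.\<close>

lemma commutator_jacobi:
  "commutator a (commutator b c) = commutator (commutator a b) c - commutator (commutator a c) b"
  by (simp add: commutator_def algebra_simps)

section \<open>Gradings of the tensor algebra\<close>

text \<open>\<open>wt = length\<close> gives the tensor powers, \<open>wt = mset\<close> the weight
  spaces, in which the number of occurrences of every letter is prescribed.\<close>

definition homog :: "('n list \<Rightarrow> 'w) \<Rightarrow> 'w \<Rightarrow> ('n, 'k::{comm_ring, comm_monoid_mult}) tensor set" where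
  "homog wt m = {a. \<forall>w\<in>Poly_Mapping.keys a. wt w = m}"

lemma tensor_power_eq_homog: "tensor_power = homog length"
  by (auto simp: tensor_power_def homog_def fun_eq_iff)

lemma tsubmodule_homog [simp]: "tsubmodule (homog wt m)"
  unfolding tsubmodule_def homog_def using keys_add by (fastforce simp: in_keys_iff lookup_add)

lemma tsubmodule_tensor_power [simp]: "tsubmodule (tensor_power q)"
  by (simp add: tensor_power_eq_homog)

lemma word_in_homog: "word w \<in> homog wt (wt w)"
  by (simp add: homog_def in_keys_iff lookup_single when_def)

lemma homog_mult:
  fixes wt :: "'n list \<Rightarrow> 'w::plus"
  assumes "\<And>u v. wt (u @ v) = wt u + wt v" "a \<in> homog wt m" "b \<in> homog wt m'"
  shows "a * b \<in> homog wt (m + m')"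
  unfolding homog_def using keys_mult[of a b] assms by (fastforce simp: homog_def plus_list_def)

text \<open>Weights are added in a commutative semigroup, so \<open>a * b\<close> and
  \<open>b * a\<close> have the same one.\<close>

lemma homog_commutator:
  fixes wt :: "'n list \<Rightarrow> 'w::ab_semigroup_add"
  assumes "\<And>u v. wt (u @ v) = wt u + wt v" "a \<in> homog wt m" "b \<in> homog wt m'"
  shows "commutator a b \<in> homog wt (m + m')"
  unfolding commutator_def using homog_mult[of wt a m b m'] homog_mult[of wt b m' a m] assms
  by (simp add: tsubmodule_diff add.commute)

lemma linear_ext_homog:
  assumes "tsubmodule N" "a \<in> homog wt m" "\<And>w. wt w = m \<Longrightarrow> g w \<in> N"
  shows "linear_ext g a \<in> N"
  by (rule tlinear_span[OF tlinear_linear_ext assms(1)]) (use assms in \<open>auto simp: homog_def\<close>)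

lemma tlinear_eq_homog:
  assumes "tlinear F" "tlinear G" "a \<in> homog wt m" "\<And>w. wt w = m \<Longrightarrow> F (word w) = G (word w)"
  shows "F a = G a"
  by (rule tlinear_eqI[OF assms(1,2)]) (use assms in \<open>auto simp: homog_def\<close>)

section \<open>Sums of components\<close>

lemma sum_of_components_incl:
  assumes "q \<in> I" "x \<in> C q"
  shows "x \<in> sum_of_components I C"
proof -
  have "x = (\<Sum>r\<in>{q}. (\<lambda>_. x) r)" by simp
  moreover have "finite {q} \<and> {q} \<subseteq> I \<and> (\<forall>r\<in>{q}. (\<lambda>_. x) r \<in> C r)" using assms by simp
  ultimately show ?thesis unfolding sum_of_components_def by blast
qed

lemma sum_of_components_zero: "0 \<in> sum_of_components I C"
proof -
  have "0 = (\<Sum>q\<in>{}. (\<lambda>_. 0) q)" by simp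
  then show ?thesis unfolding sum_of_components_def by blast
qed

lemma sum_of_components_add:
  assumes C: "\<And>q. q \<in> I \<Longrightarrow> 0 \<in> C q" "\<And>q x y. q \<in> I \<Longrightarrow> x \<in> C q \<Longrightarrow> y \<in> C q \<Longrightarrow> x + y \<in> C q"
    and "x \<in> sum_of_components I C" "y \<in> sum_of_components I C"
  shows "x + y \<in> sum_of_components I C"
proof -
  obtain F a where x: "x = sum a F" "finite F" "F \<subseteq> I" "\<forall>q\<in>F. a q \<in> C q"
    using assms(3) unfolding sum_of_components_def by blast
  obtain G b where y: "y = sum b G" "finite G" "G \<subseteq> I" "\<forall>q\<in>G. b q \<in> C q"
    using assms(4) unfolding sum_of_components_def by blast
  \<comment> \<open>Both families are extended by 0 to the union of their index sets; this is where
    \<open>0 \<in> C q\<close> is used.\<close>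
  define c where "c q = (if q \<in> F then a q else 0) + (if q \<in> G then b q else 0)" for q
  have "sum c (F \<union> G) = x + y"
    unfolding c_def sum.distrib x(1) y(1) using x(2) y(2)
    by (simp add: sum.inter_restrict[symmetric] Int_absorb1 Int_absorb2)
  moreover have "\<forall>q\<in>F \<union> G. c q \<in> C q" using x y C unfolding c_def by auto
  moreover have "finite (F \<union> G)" "F \<union> G \<subseteq> I" using x y by auto
  ultimately show ?thesis unfolding sum_of_components_def mem_Collect_eq by metis
qed

lemma sum_of_components_induct [consumes 1, case_names zero comp add]:
  assumes "x \<in> sum_of_components I C" "P 0" "\<And>q x. q \<in> I \<Longrightarrow> x \<in> C q \<Longrightarrow> P x"
    "\<And>x y. P x \<Longrightarrow> P y \<Longrightarrow> P (x + y)"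
  shows "P x"
proof -
  obtain F a where x: "x = sum a F" "finite F" "F \<subseteq> I" "\<forall>q\<in>F. a q \<in> C q"
    using assms(1) unfolding sum_of_components_def by blast
  have "P (sum a F)"
    using x(2,3,4) by (induction F rule: finite_induct) (auto intro: assms(2-))
  then show ?thesis by (simp add: x(1))
qed

text \<open>A word \<open>w\<close> can have a nonzero coefficient only in the summand of index
  \<open>length w\<close>, so its coefficient there is its coefficient in the whole sum.\<close>

lemma homog_independent:
  assumes "finite F" "\<And>q. q \<in> F \<Longrightarrow> a q \<in> tensor_power q" "(\<Sum>q\<in>F. a q) = 0" "q \<in> F"
  shows "a q = 0"
proof (rule poly_mapping_eqI)
  fix w
  have vanish: "Poly_Mapping.lookup (a r) w = 0" if "r \<in> F" "length w \<noteq> r" for r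
    using assms(2)[OF that(1)] that(2) by (auto simp: tensor_power_def in_keys_iff)
  show "Poly_Mapping.lookup (a q) w = Poly_Mapping.lookup 0 w"
  proof (cases "length w = q")
    case True
    have "0 = (\<Sum>r\<in>F. Poly_Mapping.lookup (a r) w)"
      using arg_cong[OF assms(3), of "\<lambda>a. Poly_Mapping.lookup a w"] by (simp add: lookup_sum)
    also have "\<dots> = Poly_Mapping.lookup (a q) w"
      using assms(1,4) vanish True by (subst sum.remove[of _ q]) (auto intro!: sum.neutral)
    finally show ?thesis by simp
  qed (use vanish assms(4) in auto)
qed

section \<open>Schur algebras\<close>

lemma perm_act_eq_linear_ext:
  "perm_act \<sigma> = linear_ext (\<lambda>w. word (permute_list (inv_into UNIV \<sigma>) w))"
  by (rule ext) (simp add: perm_act_def linear_ext_def tscale_word)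

lemma tlinear_perm_act [simp]: "tlinear (perm_act \<sigma>)"
  by (simp add: perm_act_eq_linear_ext)

lemma perm_act_word [simp]: "perm_act \<sigma> (word w) = word (permute_list (inv_into UNIV \<sigma>) w)"
  by (simp add: perm_act_eq_linear_ext)

lemma word_in_tensor_power: "length w = q \<Longrightarrow> word w \<in> tensor_power q"
  using word_in_homog[of w length] by (simp add: tensor_power_eq_homog)

lemma tensor_power_zero [simp]: "0 \<in> tensor_power q"
  and tensor_power_add: "a \<in> tensor_power q \<Longrightarrow> b \<in> tensor_power q \<Longrightarrow> a + b \<in> tensor_power q"
  and tensor_power_scale: "a \<in> tensor_power q \<Longrightarrow> tscale c a \<in> tensor_power q"
  using tsubmodule_tensor_power[of q] by (auto simp: tsubmodule_def)

lemma tensor_power_uminus: "a \<in> tensor_power q \<Longrightarrow> - a \<in> tensor_power q"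
  by (simp add: tsubmodule_uminus)

lemma perm_act_closed: "a \<in> tensor_power q \<Longrightarrow> perm_act \<sigma> a \<in> tensor_power q"
  unfolding perm_act_eq_linear_ext tensor_power_eq_homog
  by (rule linear_ext_homog[of _ _ length q])
    (simp_all add: word_in_tensor_power flip: tensor_power_eq_homog)

lemma schur_closed: "f \<in> schur_carrier q \<Longrightarrow> f a \<in> tensor_power q"
  unfolding schur_carrier_def by (cases "a \<in> tensor_power q") auto

lemma schur_outside: "f \<in> schur_carrier q \<Longrightarrow> a \<notin> tensor_power q \<Longrightarrow> f a = 0"
  and schur_add: "f \<in> schur_carrier q \<Longrightarrow> a \<in> tensor_power q \<Longrightarrow> b \<in> tensor_power q \<Longrightarrow> f (a + b) = f a + f b"
  and schur_scale: "f \<in> schur_carrier q \<Longrightarrow> a \<in> tensor_power q \<Longrightarrow> f (tscale c a) = tscale c (f a)"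
  and schur_perm: "f \<in> schur_carrier q \<Longrightarrow> a \<in> tensor_power q \<Longrightarrow> \<sigma> permutes {..<q} \<Longrightarrow>
    f (perm_act \<sigma> a) = perm_act \<sigma> (f a)"
  by (auto simp: schur_carrier_def)

lemma schur_zero: "f \<in> schur_carrier q \<Longrightarrow> f 0 = 0"
  using schur_scale[of f q 0 0] by simp

lemma schur_uminus: "f \<in> schur_carrier q \<Longrightarrow> a \<in> tensor_power q \<Longrightarrow> f (- a) = - f a"
  using schur_scale[of f q a "-1"] by (simp add: tscale_minus_one)

lemma schur_diff:
  "f \<in> schur_carrier q \<Longrightarrow> a \<in> tensor_power q \<Longrightarrow> b \<in> tensor_power q \<Longrightarrow> f (a - b) = f a - f b"
  using schur_add[of f q a "-b"] by (simp add: schur_uminus tensor_power_uminus)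

lemma schur_carrierI:
  assumes "\<And>a. a \<in> tensor_power q \<Longrightarrow> f a \<in> tensor_power q"
    "\<And>a. a \<notin> tensor_power q \<Longrightarrow> f a = 0"
    "\<And>a b. a \<in> tensor_power q \<Longrightarrow> b \<in> tensor_power q \<Longrightarrow> f (a + b) = f a + f b"
    "\<And>c a. a \<in> tensor_power q \<Longrightarrow> f (tscale c a) = tscale c (f a)"
    "\<And>\<sigma> a. \<sigma> permutes {..<q} \<Longrightarrow> a \<in> tensor_power q \<Longrightarrow> f (perm_act \<sigma> a) = perm_act \<sigma> (f a)"
  shows "f \<in> schur_carrier q"
  using assms by (simp add: schur_carrier_def)

text \<open>The source of concrete elements of the Schur algebra: both sides of the equivariance
  condition are linear, so it is enough that the values on words are chosen equivariantly.\<close>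

lemma schur_carrier_cutoff:
  fixes g :: "'n list \<Rightarrow> ('n, 'k::{comm_ring, comm_monoid_mult}) tensor"
  assumes "\<And>w. length w = q \<Longrightarrow> g w \<in> tensor_power q"
    "\<And>w \<sigma>. length w = q \<Longrightarrow> \<sigma> permutes {..<q} \<Longrightarrow>
      g (permute_list (inv_into UNIV \<sigma>) w) = perm_act \<sigma> (g w)"
  shows "(\<lambda>a. if a \<in> tensor_power q then linear_ext g a else 0) \<in> schur_carrier q"
proof (rule schur_carrierI)
  show "(if a \<in> tensor_power q then linear_ext g a else 0) \<in> tensor_power q" if "a \<in> tensor_power q" for a
    using that linear_ext_homog[of "tensor_power q" a length q g] assms(1)
    by (simp add: tensor_power_eq_homog)
next
  fix \<sigma> and a :: "('n, 'k) tensor" assume \<sigma>: "\<sigma> permutes {..<q}" and a: "a \<in> tensor_power q"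
  have "linear_ext g (perm_act \<sigma> a) = perm_act \<sigma> (linear_ext g a)"
    by (rule tlinear_eq_homog[of _ _ _ length q])
      (use a \<sigma> in \<open>simp_all add: tlinear_compose tensor_power_eq_homog assms(2)\<close>)
  then show "(if perm_act \<sigma> a \<in> tensor_power q then linear_ext g (perm_act \<sigma> a) else 0) =
      perm_act \<sigma> (if a \<in> tensor_power q then linear_ext g a else 0)"
    using a by (simp add: perm_act_closed)
qed (simp_all add: tensor_power_add tensor_power_scale tlinear_add tlinear_scale)

lemma schur_carrier_zero: "(\<lambda>_. 0) \<in> schur_carrier q"
  by (rule schur_carrierI) (simp_all add: tlinear_zero)

lemma schur_carrier_one: "(\<lambda>a. if a \<in> tensor_power q then a else 0) \<in> schur_carrier q"
  by (rule schur_carrierI) (auto simp: tensor_power_add tensor_power_scale perm_act_closed)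

lemma schur_carrier_add:
  "f \<in> schur_carrier q \<Longrightarrow> g \<in> schur_carrier q \<Longrightarrow> (\<lambda>a. f a + g a) \<in> schur_carrier q"
  by (rule schur_carrierI)
    (simp_all add: schur_closed schur_outside schur_add schur_scale schur_perm tensor_power_add
      tscale_right_distrib tlinear_add add_ac)

lemma schur_carrier_scale:
  "f \<in> schur_carrier q \<Longrightarrow> (\<lambda>a. tscale c (f a)) \<in> schur_carrier q"
  by (rule schur_carrierI)
    (simp_all add: schur_closed schur_outside schur_add schur_scale schur_perm tensor_power_scale
      tscale_right_distrib tlinear_scale tscale_tscale mult.commute)

lemma schur_carrier_uminus: "f \<in> schur_carrier q \<Longrightarrow> (\<lambda>a. - f a) \<in> schur_carrier q"
  using schur_carrier_scale[of f q "-1"] by (simp add: tscale_minus_one)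

lemma schur_carrier_compose:
  "f \<in> schur_carrier q \<Longrightarrow> g \<in> schur_carrier q \<Longrightarrow> f \<circ> g \<in> schur_carrier q"
  by (rule schur_carrierI)
    (simp_all add: schur_closed schur_outside schur_add schur_scale schur_perm schur_zero)

section \<open>The Schur algebra as a ring, and its modules\<close>

lemma carrier_Schur [simp]: "carrier (Schur q) = schur_carrier q"
  by (simp add: Schur_def)

lemma ring_Schur: "ring (Schur q)"
proof (rule ringI)
  show "abelian_group (Schur q)"
    by (rule abelian_groupI)
      (auto simp: Schur_def schur_carrier_zero schur_carrier_add add_ac
        intro!: bexI[OF _ schur_carrier_uminus])
  \<comment> \<open>For the right unit law outside the tensor power: the cut-off identity gives 0
    there, and \<open>f 0 = 0\<close> agrees with the default value of \<open>f\<close>.\<close>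
  show "monoid (Schur q)"
    by (rule monoidI)
      (auto simp: Schur_def schur_carrier_one schur_carrier_compose schur_closed schur_outside
        schur_zero fun_eq_iff)
qed (auto simp: Schur_def schur_add schur_closed fun_eq_iff)

lemma left_module_onI:
  assumes "0 \<in> C" "\<And>x y. x \<in> C \<Longrightarrow> y \<in> C \<Longrightarrow> x + y \<in> C" "\<And>x. x \<in> C \<Longrightarrow> - x \<in> C"
    "\<And>f x. f \<in> schur_carrier q \<Longrightarrow> x \<in> C \<Longrightarrow> act f x \<in> C"
    "\<And>f g x. f \<in> schur_carrier q \<Longrightarrow> g \<in> schur_carrier q \<Longrightarrow> x \<in> C \<Longrightarrow>
      act (\<lambda>a. f a + g a) x = act f x + act g x"
    "\<And>f x y. f \<in> schur_carrier q \<Longrightarrow> x \<in> C \<Longrightarrow> y \<in> C \<Longrightarrow> act f (x + y) = act f x + act f y"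
    "\<And>f g x. f \<in> schur_carrier q \<Longrightarrow> g \<in> schur_carrier q \<Longrightarrow> x \<in> C \<Longrightarrow> act (f \<circ> g) x = act f (act g x)"
    "\<And>x. x \<in> C \<Longrightarrow> act (\<lambda>a. if a \<in> tensor_power q then a else 0) x = x"
  shows "left_module (Schur q) (module_on C act)"
proof (rule left_module.intro)
  show "abelian_group (module_on C act)"
    by (rule abelian_groupI)
      (auto simp: module_on_def assms(1,2) add_ac intro!: bexI[OF _ assms(3)])
  show "left_module_axioms (Schur q) (module_on C act)"
    by standard (simp_all add: module_on_def Schur_def assms(4-))
qed (rule ring_Schur)

section \<open>Left-normed brackets\<close>

text \<open>The first letter of the word is the outermost one in the bracket.\<close>

fun left_normed :: "'n list \<Rightarrow> ('n, 'k::{comm_ring, comm_monoid_mult}) tensor" where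
  "left_normed [] = 0"
| "left_normed [i] = gen i"
| "left_normed (i # j # w) = commutator (left_normed (j # w)) (gen i)"

lemma left_normed_Cons: "w \<noteq> [] \<Longrightarrow> left_normed (i # w) = commutator (left_normed w) (gen i)"
  by (cases w) simp_all

text \<open>
  Combinations of place permutations of words of length \<open>q\<close>.  A permutation is encoded as the list of
  the places its letters are taken from.
\<close>

inductive perm_comb :: "nat \<Rightarrow> ('n list \<Rightarrow> ('n, 'k::{comm_ring, comm_monoid_mult}) tensor) \<Rightarrow> bool"
  for q where
  perm: "mset p = mset [0..<q] \<Longrightarrow> perm_comb q (\<lambda>w. word (map ((!) w) p))"
| diff: "perm_comb q g \<Longrightarrow> perm_comb q h \<Longrightarrow> perm_comb q (\<lambda>w. g w - h w)"

lemma mset_map_Suc_upt: "mset p = mset [0..<q] \<Longrightarrow> mset (map Suc p) = mset [1..<Suc q]"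
  by (metis One_nat_def map_Suc_upt mset_map)

text \<open>The old word starts at place 1 of the new one, so all places shift by one; place 0, the
  added letter, is read last.\<close>

lemma perm_comb_mult_gen:
  assumes "perm_comb q g"
  shows "\<exists>g'. perm_comb (Suc q) g' \<and> (\<forall>i w. g' (i # w) = g w * gen i)"
  using assms
proof induction
  case (perm p)
  have "mset (map Suc p @ [0]) = mset [0..<Suc q]"
    unfolding mset_append mset_map_Suc_upt[OF perm] by (subst (2) upt_conv_Cons) simp_all
  from perm_comb.perm[OF this] show ?case
    by (intro exI conjI) (auto simp: gen_def word_mult comp_def)
next
  case (diff g h)
  then obtain g' h' where "perm_comb (Suc q) g'" "\<forall>i w. g' (i # w) = g w * gen i"
    "perm_comb (Suc q) h'" "\<forall>i w. h' (i # w) = h w * gen i" by blast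
  then show ?case
    by (intro exI[of _ "\<lambda>w. g' w - h' w"]) (simp add: perm_comb.diff left_diff_distrib)
qed

text \<open>As before, with place 0 read first.\<close>

lemma perm_comb_gen_mult:
  assumes "perm_comb q g"
  shows "\<exists>g'. perm_comb (Suc q) g' \<and> (\<forall>i w. g' (i # w) = gen i * g w)"
  using assms
proof induction
  case (perm p)
  have "mset (0 # map Suc p) = mset [0..<Suc q]"
    unfolding mset.simps mset_map_Suc_upt[OF perm] by (subst (2) upt_conv_Cons) simp_all
  from perm_comb.perm[OF this] show ?case
    by (intro exI conjI) (auto simp: gen_def word_mult comp_def)
next
  case (diff g h)
  then obtain g' h' where "perm_comb (Suc q) g'" "\<forall>i w. g' (i # w) = gen i * g w"
    "perm_comb (Suc q) h'" "\<forall>i w. h' (i # w) = gen i * h w" by blast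
  then show ?case
    by (intro exI[of _ "\<lambda>w. g' w - h' w"]) (simp add: perm_comb.diff right_diff_distrib)
qed

text \<open>By induction: bracketing with the first letter subtracts left from right multiplication
  by it, and each of these turns place permutations into place permutations. The quantifier order
  matters: \<open>g\<close> is the same for all words of the given length.\<close>

lemma perm_comb_left_normed:
  "\<exists>g. perm_comb (Suc q) g \<and>
    (\<forall>w. length w = Suc q \<longrightarrow> left_normed w = (g w :: ('n, 'k::{comm_ring, comm_monoid_mult}) tensor))"
proof (induction q)
  case 0
  have "perm_comb (Suc 0) (\<lambda>w. word (map ((!) w) [0]) :: ('n, 'k) tensor)"
    by (rule perm_comb.perm) simp
  then show ?case by (intro exI conjI) (auto simp: length_Suc_conv gen_def)
next
  case (Suc q)
  then obtain g where g: "perm_comb (Suc q) g"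
    "\<forall>w. length w = Suc q \<longrightarrow> left_normed w = (g w :: ('n, 'k) tensor)"
    by blast
  obtain h where h: "perm_comb (Suc (Suc q)) h" "\<forall>i w. h (i # w) = g w * gen i"
    using perm_comb_mult_gen[OF g(1)] by blast
  obtain h' where h': "perm_comb (Suc (Suc q)) h'" "\<forall>i w. h' (i # w) = gen i * g w"
    using perm_comb_gen_mult[OF g(1)] by blast
  have "left_normed w = h w - h' w" if len: "length w = Suc (Suc q)" for w
  proof -
    from len obtain i u where w: "w = i # u" and u: "length u = Suc q" by (auto simp: length_Suc_conv)
    from u have "u \<noteq> []" by auto
    then show ?thesis using g(2) h(2) h'(2) u by (simp add: w left_normed_Cons commutator_def)
  qed
  with h h' show ?case by (intro exI[of _ "\<lambda>w. h w - h' w"]) (simp add: perm_comb.diff)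
qed

text \<open>Since \<open>f\<close> respects differences only inside the tensor power, closedness has
  to be proved in the same induction.\<close>

lemma schur_commute_perm_comb:
  assumes "perm_comb q g" "f \<in> schur_carrier q" "a \<in> tensor_power q"
  shows "linear_ext g a \<in> tensor_power q \<and> f (linear_ext g a) = linear_ext g (f a)"
  using assms(1)
proof induction
  case (perm p)
  obtain \<tau> where \<tau>: "\<tau> permutes {..<q}" "permute_list \<tau> [0..<q] = p"
    using mset_eq_permutation[OF perm] by auto
  have p: "p = map \<tau> [0..<q]"
  proof (rule nth_equalityI)
    show "length p = length (map \<tau> [0..<q])"
      using \<tau>(2) by auto
    fix k assume "k < length p"
    then have "k < q" using \<tau>(2) by auto
    moreover from this have "\<tau> k < q" using permutes_in_image[OF \<tau>(1), of k] by simp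
    ultimately show "p ! k = map \<tau> [0..<q] ! k"
      unfolding \<tau>(2)[symmetric] by (simp add: permute_list_def)
  qed
  have inv: "inv_into UNIV (inv_into UNIV \<tau>) = \<tau>"
    by (rule inv_inv_eq[OF permutes_bij[OF \<tau>(1)]])
  \<comment> \<open>\<open>perm_act \<sigma>\<close> takes its letters from the places given by the
    inverse of \<open>\<sigma>\<close>, whereas \<open>p\<close> takes them from the places given by
    \<open>\<tau>\<close>; hence the inverse of \<open>\<tau>\<close>.\<close>
  have eq: "linear_ext (\<lambda>w. word (map ((!) w) p)) b = perm_act (inv_into UNIV \<tau>) b"
    if "b \<in> tensor_power q" for b :: "('a, 'b) tensor"
  proof (rule tlinear_eq_homog[of "linear_ext _" "perm_act _" b length q])
    fix w :: "'a list" assume "length w = q"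
    then show "linear_ext (\<lambda>w. word (map ((!) w) p)) (word w) = perm_act (inv_into UNIV \<tau>) (word w)"
      by (simp add: p inv permute_list_def comp_def)
  qed (use that in \<open>simp_all add: tensor_power_eq_homog\<close>)
  show ?case
    unfolding eq[OF assms(3)] eq[OF schur_closed[OF assms(2)]]
    by (intro conjI perm_act_closed[OF assms(3)] schur_perm[OF assms(2,3) permutes_inv[OF \<tau>(1)]])
next
  case (diff g h)
  then have closed: "linear_ext g a \<in> tensor_power q" "linear_ext h a \<in> tensor_power q" by auto
  then show ?case
    unfolding linear_ext_diff schur_diff[OF assms(2) closed] using diff.IH
    by (simp add: tsubmodule_diff)
qed

lemma schur_commute_left_normed:
  assumes "f \<in> schur_carrier q" "a \<in> tensor_power q"
  shows "f (linear_ext left_normed a) = linear_ext left_normed (f a)"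
proof (cases q)
  \<comment> \<open>In degree 0 the bracketing map is zero, because
    \<open>left_normed [] = 0\<close>.\<close>
  case 0
  have "linear_ext left_normed b = (0 :: ('a, 'b) tensor)" if "b \<in> tensor_power q" for b :: "('a, 'b) tensor"
    using linear_ext_homog[of "{0}" b length q left_normed] that
    by (simp add: tensor_power_eq_homog 0 tsubmodule_def)
  then show ?thesis using assms by (simp add: schur_zero schur_closed)
next
  case (Suc r)
  obtain g where g: "perm_comb q g"
    "\<And>w. length w = q \<Longrightarrow> left_normed w = (g w :: ('a, 'b) tensor)"
    using perm_comb_left_normed[of r] Suc by blast
  have "linear_ext left_normed b = linear_ext g b" if "b \<in> tensor_power q" for b
    by (rule tlinear_eq_homog[of _ _ _ length q])
      (use that in \<open>simp_all add: tensor_power_eq_homog g\<close>)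
  then show ?thesis
    using schur_commute_perm_comb[OF g(1) assms] assms by (simp add: schur_closed)
qed

section \<open>The free Lie algebra\<close>

lemma gen_eq_word: "gen i = word [i]"
  by (simp add: gen_def)

lemma tsubmodule_free_lie_comp [simp]: "tsubmodule (free_lie_comp p)"
  by (auto simp: tsubmodule_def free_lie_comp_def intro: has_bracket_length.intros)

lemma has_bracket_length_left_normed: "has_bracket_length (length w) (left_normed w)"
proof (induction w rule: left_normed.induct)
  case (3 i j w)
  then show ?case
    using has_bracket_length.bracket[OF _ has_bracket_length.gen, of _ "left_normed (j # w)" i] by simp
qed (use has_bracket_length.gen in \<open>auto intro: has_bracket_length.zero\<close>)

lemma left_normed_comp: "length w = q \<Longrightarrow> left_normed w \<in> free_lie_comp q"
  using has_bracket_length_left_normed[of w] by (auto simp: free_lie_comp_def)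

lemma tsubmodule_left_normed: "tsubmodule (linear_ext left_normed ` tensor_power q)"
  by (simp add: tsubmodule_image)

lemma left_normed_image: "length w = q \<Longrightarrow> left_normed w \<in> linear_ext left_normed ` tensor_power q"
  using word_in_tensor_power[of w q] by (intro image_eqI[of _ _ "word w"]) simp_all

text \<open>With \<open>v\<close> extended by a letter \<open>x_i\<close>, the Jacobi identity gives
  \<open>[u, [v, x_i]] = [[u, v], x_i] - [[u, x_i], v]\<close>. The first term is the induction
  hypothesis for \<open>u\<close>, bracketed once more; the second is the induction hypothesis for
  \<open>i # u\<close>, which is why \<open>u\<close> is arbitrary.\<close>

lemma commutator_left_normed:
  fixes u v :: "'n list"
  shows "commutator (left_normed u) (left_normed v :: ('n, 'k::{comm_ring, comm_monoid_mult}) tensor)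
    \<in> linear_ext left_normed ` tensor_power (length u + length v)"
proof (induction v arbitrary: u)
  case Nil
  then show ?case by (simp add: tsubmodule_zero tsubmodule_left_normed)
next
  case (Cons i v)
  have gen: "commutator (left_normed u) (gen i :: ('n, 'k) tensor)
      \<in> linear_ext left_normed ` tensor_power (Suc (length u))" for u
  proof (cases "u = []")
    case True
    then show ?thesis by (simp add: tsubmodule_zero tsubmodule_left_normed)
  next
    case False
    then show ?thesis using left_normed_image[of "i # u"] by (simp add: left_normed_Cons)
  qed
  show ?case
  proof (cases "v = []")
    case True
    then show ?thesis using gen[of u] by simp
  next
    case v: False
    obtain t :: "('n, 'k) tensor"
      where t: "commutator (left_normed u) (left_normed v) = linear_ext left_normed t"
      "t \<in> tensor_power (length u + length v)"
      using Cons.IH[of u] by blast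
    have "commutator (linear_ext left_normed t) (gen i)
        \<in> linear_ext left_normed ` tensor_power (Suc (length u + length v))"
      by (rule tlinear_span[OF tlinear_commutator_left[OF tlinear_linear_ext] tsubmodule_left_normed])
        (use t(2) gen in \<open>force simp: tensor_power_def\<close>)
    moreover have "commutator (commutator (left_normed u) (gen i)) (left_normed v :: ('n, 'k) tensor)
        \<in> linear_ext left_normed ` tensor_power (Suc (length u + length v))"
    proof (cases "u = []")
      case True
      then show ?thesis by (simp add: tsubmodule_zero tsubmodule_left_normed)
    next
      case False
      then show ?thesis using Cons.IH[of "i # u"] by (simp add: left_normed_Cons)
    qed
    ultimately show ?thesis
      using v by (simp add: left_normed_Cons commutator_jacobi t tsubmodule_diff tsubmodule_left_normed)
  qed
qed

text \<open>The bracket case expands both arguments into left-normed brackets by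
  bilinearity.\<close>

lemma has_bracket_length_image:
  "has_bracket_length q a \<Longrightarrow> a \<in> linear_ext left_normed ` tensor_power q"
proof (induction rule: has_bracket_length.induct)
  case (gen i)
  then show ?case using left_normed_image[of "[i]" 1] by simp
next
  case (bracket p a q b)
  then obtain s t where s: "a = linear_ext left_normed s" "s \<in> tensor_power p"
    and t: "b = linear_ext left_normed t" "t \<in> tensor_power q" by blast
  show ?case
    unfolding s(1)
  proof (rule tlinear_span[OF tlinear_commutator_left[OF tlinear_linear_ext] tsubmodule_left_normed])
    fix u assume "u \<in> Poly_Mapping.keys s"
    then have u: "length u = p" using s(2) by (simp add: tensor_power_def)
    show "commutator (linear_ext left_normed (word u)) b \<in> linear_ext left_normed ` tensor_power (p + q)"
      unfolding t(1)
    proof (rule tlinear_span[OF tlinear_commutator_right[OF tlinear_linear_ext] tsubmodule_left_normed])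
      fix v assume "v \<in> Poly_Mapping.keys t"
      then have "length v = q" using t(2) by (simp add: tensor_power_def)
      then show "commutator (linear_ext left_normed (word u)) (linear_ext left_normed (word v))
          \<in> linear_ext left_normed ` tensor_power (p + q)"
        using commutator_left_normed[of u v] u by simp
    qed
  qed
qed (simp_all add: tsubmodule_zero tsubmodule_add tsubmodule_scale tsubmodule_left_normed)

lemma free_lie_comp_eq: "free_lie_comp q = linear_ext left_normed ` tensor_power q"
proof
  show "linear_ext left_normed ` tensor_power q \<subseteq> free_lie_comp q"
    using linear_ext_homog[of "free_lie_comp q" _ length q left_normed] left_normed_comp
    by (auto simp: tensor_power_eq_homog)
qed (auto simp: free_lie_comp_def has_bracket_length_image)

lemma free_lie_comp_tensor_power: "free_lie_comp q \<subseteq> tensor_power q"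
proof
  fix a :: "('a, 'b) tensor"
  assume "a \<in> free_lie_comp q"
  then have "has_bracket_length q a" by (simp add: free_lie_comp_def)
  then show "a \<in> tensor_power q"
  proof induction
    case (bracket p a q b)
    then show ?case by (simp add: tensor_power_eq_homog homog_commutator)
  qed (simp_all add: gen_eq_word word_in_tensor_power tensor_power_add tensor_power_scale)
qed

text \<open>Writing \<open>a\<close> as the bracketing of a tensor \<open>t\<close>, one gets
  \<open>f a\<close> as the bracketing of \<open>f t\<close>.\<close>

lemma schur_free_lie_comp:
  assumes "f \<in> schur_carrier q" "a \<in> free_lie_comp q"
  shows "f a \<in> free_lie_comp q"
  using assms by (auto simp: free_lie_comp_eq schur_commute_left_normed schur_closed)

section \<open>The Lie algebra generated by the letters and its grading\<close>

lemma lie_subalgebra_free_lie: "lie_subalgebra tscale commutator free_lie"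
  unfolding free_lie_def by (rule hull_in) (auto simp: lie_subalgebra_def)

lemma gen_free_lie [simp]: "gen i \<in> free_lie"
  unfolding free_lie_def by (rule hull_inc) simp

lemma free_lie_zero [simp]: "0 \<in> free_lie"
  and free_lie_add: "a \<in> free_lie \<Longrightarrow> b \<in> free_lie \<Longrightarrow> a + b \<in> free_lie"
  and free_lie_scale: "a \<in> free_lie \<Longrightarrow> tscale c a \<in> free_lie"
  and free_lie_commutator: "a \<in> free_lie \<Longrightarrow> b \<in> free_lie \<Longrightarrow> commutator a b \<in> free_lie"
  using lie_subalgebra_free_lie by (auto simp: lie_subalgebra_def)

lemma free_lie_diff: "a \<in> free_lie \<Longrightarrow> b \<in> free_lie \<Longrightarrow> a - b \<in> free_lie"
  by (rule tsubmodule_diff) (auto simp: tsubmodule_def free_lie_add free_lie_scale)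

text \<open>Membership is carried along because derivations obey their laws only on
  \<open>free_lie\<close>.\<close>

lemma free_lie_induct [consumes 1, case_names gen zero add scale commutator]:
  assumes "a \<in> free_lie" "\<And>i. P (gen i)" "P 0"
    "\<And>a b. a \<in> free_lie \<Longrightarrow> b \<in> free_lie \<Longrightarrow> P a \<Longrightarrow> P b \<Longrightarrow> P (a + b)"
    "\<And>c a. a \<in> free_lie \<Longrightarrow> P a \<Longrightarrow> P (tscale c a)"
    "\<And>a b. a \<in> free_lie \<Longrightarrow> b \<in> free_lie \<Longrightarrow> P a \<Longrightarrow> P b \<Longrightarrow> P (commutator a b)"
  shows "P a"
proof -
  have "a \<in> free_lie \<and> P a"
    using assms(1) unfolding free_lie_def
  proof (rule hull_induct)
    show "lie_subalgebra tscale commutator {a. a \<in> lie_subalgebra tscale commutator hull range gen \<and> P a}"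
      unfolding free_lie_def[symmetric] lie_subalgebra_def
      by (simp add: assms(3-) free_lie_add free_lie_scale free_lie_commutator)
  qed (use assms(2) in \<open>auto simp flip: free_lie_def\<close>)
  then show ?thesis ..
qed

lemma free_lie_comp_free_lie: "free_lie_comp q \<subseteq> free_lie"
proof
  fix a :: "('a, 'b) tensor"
  assume "a \<in> free_lie_comp q"
  then have "has_bracket_length q a" by (simp add: free_lie_comp_def)
  then show "a \<in> free_lie"
    by induction (auto intro: free_lie_add free_lie_scale free_lie_commutator)
qed

lemma free_lie_comp_zero [simp]: "0 \<in> free_lie_comp q"
  and free_lie_comp_add: "a \<in> free_lie_comp q \<Longrightarrow> b \<in> free_lie_comp q \<Longrightarrow> a + b \<in> free_lie_comp q"
  and free_lie_comp_scale: "a \<in> free_lie_comp q \<Longrightarrow> tscale c a \<in> free_lie_comp q"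
  and free_lie_comp_commutator:
    "a \<in> free_lie_comp p \<Longrightarrow> b \<in> free_lie_comp q \<Longrightarrow> commutator a b \<in> free_lie_comp (p + q)"
  by (auto simp: free_lie_comp_def intro: has_bracket_length.intros)

text \<open>The sum of the components contains the generators and is itself a Lie subalgebra, as
  bracket lengths add; conversely every component consists of Lie elements.\<close>

lemma free_lie_eq:
  "free_lie = (sum_of_components {1..} free_lie_comp :: ('n, 'k::{comm_ring, comm_monoid_mult}) tensor set)"
    (is "_ = ?L")
proof
  have sum_add: "a + b \<in> ?L" if "a \<in> ?L" "b \<in> ?L" for a b
    using that by (rule sum_of_components_add[rotated 2]) (simp_all add: free_lie_comp_add)
  have incl: "a \<in> ?L" if "a \<in> free_lie_comp q" "q \<in> {1..}" for a q
    using that(2,1) by (rule sum_of_components_incl)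
  have scale: "tscale c a \<in> ?L" if "a \<in> ?L" for a c
    using that
  proof (induction rule: sum_of_components_induct)
    case zero show ?case by (simp add: sum_of_components_zero)
  next
    case (comp q a) then show ?case by (intro incl free_lie_comp_scale)
  next
    case (add a b) then show ?case unfolding tscale_right_distrib by (rule sum_add)
  qed
  have comm: "commutator a b \<in> ?L" if "a \<in> ?L" "b \<in> ?L" for a b
    using that(1)
  proof (induction rule: sum_of_components_induct)
    case zero show ?case by (simp add: sum_of_components_zero)
  next
    case (comp p a)
    show ?case
      using that(2)
    proof (induction rule: sum_of_components_induct)
      case zero show ?case by (simp add: sum_of_components_zero)
    next
      case (comp q b)
      then show ?case
        using \<open>p \<in> {1..}\<close> \<open>a \<in> free_lie_comp p\<close>
        by (intro incl[of _ "p + q"] free_lie_comp_commutator) auto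
    next
      case (add b b')
      then show ?case
        unfolding tlinear_add[OF tlinear_commutator_right[OF tlinear_id]] by (rule sum_add)
    qed
  next
    case (add a a')
    then show ?case
      unfolding tlinear_add[OF tlinear_commutator_left[OF tlinear_id]] by (rule sum_add)
  qed
  show "free_lie \<subseteq> ?L"
  proof
    fix a :: "('n, 'k) tensor"
    assume "a \<in> free_lie"
    then show "a \<in> ?L"
    proof (induction rule: free_lie_induct)
      case (gen i)
      show ?case
        by (rule incl[of _ 1]) (use has_bracket_length.gen in \<open>auto simp: free_lie_comp_def\<close>)
    next
      case zero show ?case by (rule sum_of_components_zero)
    qed (intro sum_add scale comm; assumption)+
  qed
  show "?L \<subseteq> free_lie"
  proof
    fix a :: "('n, 'k) tensor"
    assume "a \<in> ?L"
    then show "a \<in> free_lie"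
      by (induction rule: sum_of_components_induct)
        (use free_lie_comp_free_lie in \<open>auto intro: free_lie_add\<close>)
  qed
qed

section \<open>Derivations\<close>

fun word_deriv :: "('n \<Rightarrow> ('n, 'k::{comm_ring, comm_monoid_mult}) tensor) \<Rightarrow> 'n list \<Rightarrow> ('n, 'k) tensor" where
  "word_deriv u [] = 0"
| "word_deriv u (i # w) = u i * word w + gen i * word_deriv u w"

definition tensor_deriv ::
    "('n \<Rightarrow> ('n, 'k::{comm_ring, comm_monoid_mult}) tensor) \<Rightarrow> ('n, 'k) tensor \<Rightarrow> ('n, 'k) tensor" where
  "tensor_deriv u = linear_ext (word_deriv u)"

lemma tlinear_tensor_deriv [simp]: "tlinear (tensor_deriv u)"
  by (simp add: tensor_deriv_def)

lemma empty_word_mult: "word [] * a = a"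
  by (simp flip: tscale_eq_mult)

lemma mult_empty_word: "a * word [] = a"
  by (rule tlinear_eqI[of "\<lambda>a. a * word []" "\<lambda>a. a"])
    (simp_all add: tlinear_mult_right tlinear_id word_mult)

lemma word_Cons: "word (i # w) = gen i * word w"
  by (simp add: gen_eq_word word_mult)

lemma word_deriv_append: "word_deriv u (v @ w) = word_deriv u v * word w + word v * word_deriv u w"
proof (induction v)
  case Nil
  show ?case by (simp add: empty_word_mult)
next
  case (Cons i v)
  show ?case
    by (simp add: Cons.IH word_Cons distrib_left distrib_right mult.assoc add.assoc word_mult)
qed

text \<open>Both sides are bilinear; on words the Leibniz rule is the formula for
  \<open>word_deriv\<close> of a concatenation.\<close>

lemma tensor_deriv_mult: "tensor_deriv u (a * b) = tensor_deriv u a * b + a * tensor_deriv u b"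
proof (rule tlinear_eqI[of "\<lambda>a. tensor_deriv u (a * b)" "\<lambda>a. tensor_deriv u a * b + a * tensor_deriv u b"])
  fix v
  show "tensor_deriv u (word v * b) = tensor_deriv u (word v) * b + word v * tensor_deriv u b"
    by (rule tlinear_eqI[of "\<lambda>b. tensor_deriv u (word v * b)"
          "\<lambda>b. tensor_deriv u (word v) * b + word v * tensor_deriv u b"])
      (simp_all add: tensor_deriv_def word_mult word_deriv_append tlinear_plus tlinear_mult_left
        tlinear_id tlinear_compose[of "linear_ext (word_deriv u)" "\<lambda>b. word v * b"])
qed (simp_all add: tlinear_plus tlinear_mult_right tlinear_id
      tlinear_compose[of "tensor_deriv u" "\<lambda>a. a * b"])

lemma tensor_deriv_commutator:
  "tensor_deriv u (commutator a b) = commutator (tensor_deriv u a) b + commutator a (tensor_deriv u b)"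
  by (simp add: commutator_def tlinear_diff tensor_deriv_mult)

lemma tensor_deriv_gen [simp]: "tensor_deriv u (gen i) = u i"
  by (simp add: tensor_deriv_def gen_eq_word mult_empty_word)

text \<open>Each term of the derivation replaces one letter \<open>k\<close> by \<open>u k\<close>,
  which restores \<open>k\<close> in the weight and adds \<open>N\<close>.\<close>

lemma tensor_deriv_homog_mset:
  assumes "\<And>k. u k \<in> homog mset (add_mset k N)" "a \<in> homog mset M"
  shows "tensor_deriv u a \<in> homog mset (M + N)"
proof -
  have "word_deriv u w \<in> homog mset (mset w + N)" for w
  proof (induction w)
    case Nil
    then show ?case by (simp add: tsubmodule_zero)
  next
    case (Cons i w)
    have "u i * word w \<in> homog mset (add_mset i N + mset w)"
      using assms(1) word_in_homog[of w mset] by (intro homog_mult) auto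
    moreover have "gen i * word_deriv u w \<in> homog mset ({#i#} + (mset w + N))"
      using Cons word_in_homog[of "[i]" mset] by (intro homog_mult) (auto simp: gen_eq_word)
    ultimately show ?case by (simp add: tsubmodule_add add.commute)
  qed
  then show ?thesis
    unfolding tensor_deriv_def
    by (intro linear_ext_homog[OF tsubmodule_homog assms(2)]) auto
qed

section \<open>Derivations of the free Lie algebra\<close>

lemma derivation_outside: "is_derivation D \<Longrightarrow> a \<notin> free_lie \<Longrightarrow> D a = 0"
  and derivation_add: "is_derivation D \<Longrightarrow> a \<in> free_lie \<Longrightarrow> b \<in> free_lie \<Longrightarrow> D (a + b) = D a + D b"
  and derivation_scale: "is_derivation D \<Longrightarrow> a \<in> free_lie \<Longrightarrow> D (tscale c a) = tscale c (D a)"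
  and derivation_commutator: "is_derivation D \<Longrightarrow> a \<in> free_lie \<Longrightarrow> b \<in> free_lie \<Longrightarrow>
    D (commutator a b) = commutator (D a) b + commutator a (D b)"
  unfolding is_derivation_def by blast+

lemma derivation_closed: "is_derivation D \<Longrightarrow> D a \<in> free_lie"
  unfolding is_derivation_def by (cases "a \<in> free_lie") simp_all

lemma derivation_zero: "is_derivation D \<Longrightarrow> D 0 = 0"
  using derivation_scale[of D 0 0] by simp

lemma is_derivationI:
  assumes "\<And>a. a \<in> free_lie \<Longrightarrow> D a \<in> free_lie" "\<And>a. a \<notin> free_lie \<Longrightarrow> D a = 0"
    "\<And>a b. a \<in> free_lie \<Longrightarrow> b \<in> free_lie \<Longrightarrow> D (a + b) = D a + D b"
    "\<And>c a. a \<in> free_lie \<Longrightarrow> D (tscale c a) = tscale c (D a)"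
    "\<And>a b. a \<in> free_lie \<Longrightarrow> b \<in> free_lie \<Longrightarrow>
      D (commutator a b) = commutator (D a) b + commutator a (D b)"
  shows "is_derivation D"
  using assms by (simp add: is_derivation_def)

lemma derivation_eqI:
  assumes D: "is_derivation D" and D': "is_derivation D'" and gen: "\<And>i. D (gen i) = D' (gen i)"
  shows "D = D'"
proof
  fix a
  show "D a = D' a"
  proof (cases "a \<in> free_lie")
    case True
    then show ?thesis
    proof (induction rule: free_lie_induct)
      case (add a b)
      then show ?case by (simp add: derivation_add[OF D] derivation_add[OF D'])
    next
      case (scale c a)
      then show ?case by (simp add: derivation_scale[OF D] derivation_scale[OF D'])
    next
      case (commutator a b)
      then show ?case by (simp add: derivation_commutator[OF D] derivation_commutator[OF D'])
    qed (simp_all add: gen derivation_zero[OF D] derivation_zero[OF D'])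
  qed (simp add: derivation_outside[OF D] derivation_outside[OF D'])
qed

text \<open>The point is that the tensor derivation maps Lie elements to Lie elements: it does so on
  generators, and the Leibniz rule for commutators propagates this.\<close>

lemma is_derivation_tensor_deriv:
  assumes "\<And>i. u i \<in> free_lie"
  shows "is_derivation (\<lambda>a. if a \<in> free_lie then tensor_deriv u a else 0)"
proof -
  have "tensor_deriv u a \<in> free_lie" if "a \<in> free_lie" for a
    using that
    by (induction rule: free_lie_induct)
      (simp_all add: assms tlinear_zero tlinear_add tlinear_scale tensor_deriv_commutator
        free_lie_add free_lie_scale free_lie_commutator)
  then show ?thesis
    by (intro is_derivationI)
      (simp_all add: free_lie_add free_lie_scale free_lie_commutator tlinear_add tlinear_scale
        tensor_deriv_commutator)
qed

text \<open>Uniqueness resolves the definite description, so values of \<open>der_of\<close> and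
  \<open>Phi\<close> can be found by exhibiting a derivation with the right values on
  generators.\<close>

lemma der_of_eqI:
  assumes "is_derivation D" "\<And>i. D (gen i) = u i"
  shows "der_of u = D"
  unfolding der_of_def using assms by (intro the_equality) (auto intro!: derivation_eqI)

lemma der_of_eq:
  assumes "\<And>i. u i \<in> free_lie"
  shows "der_of u = (\<lambda>a. if a \<in> free_lie then tensor_deriv u a else 0)"
  using is_derivation_tensor_deriv[OF assms] by (rule der_of_eqI) simp_all

lemma is_derivation_der_of: "(\<And>i. u i \<in> free_lie) \<Longrightarrow> is_derivation (der_of u)"
  by (simp add: der_of_eq is_derivation_tensor_deriv)

lemma der_of_gen: "(\<And>i. u i \<in> free_lie) \<Longrightarrow> der_of u (gen i) = u i"
  by (simp add: der_of_eq)

lemma is_derivation_zero: "is_derivation 0"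
  by (rule is_derivationI) simp_all

lemma is_derivation_add: "is_derivation D \<Longrightarrow> is_derivation D' \<Longrightarrow> is_derivation (D + D')"
  by (rule is_derivationI)
    (simp_all add: derivation_closed derivation_outside derivation_add derivation_scale
      derivation_commutator free_lie_add tscale_right_distrib add_ac
      tlinear_add[OF tlinear_commutator_left[OF tlinear_id]]
      tlinear_add[OF tlinear_commutator_right[OF tlinear_id]])

lemma is_derivation_scale: "is_derivation D \<Longrightarrow> is_derivation (der_scale c D)"
  unfolding der_scale_def
  by (rule is_derivationI)
    (simp_all add: derivation_closed derivation_outside derivation_add derivation_scale
      derivation_commutator free_lie_scale tscale_right_distrib tscale_tscale mult.commute
      tlinear_scale[OF tlinear_commutator_left[OF tlinear_id]]
      tlinear_scale[OF tlinear_commutator_right[OF tlinear_id]])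

lemma uminus_eq_der_scale: "- D = der_scale (- 1) D"
  by (simp add: der_scale_def tscale_minus_one fun_eq_iff)

text \<open>The mixed terms \<open>commutator (D a) (D' b)\<close> and
  \<open>commutator (D' a) (D b)\<close> cancel.\<close>

lemma is_derivation_bracket:
  assumes D: "is_derivation D" and D': "is_derivation D'"
  shows "is_derivation (der_bracket D D')"
  unfolding der_bracket_def
proof (rule is_derivationI)
  fix a b :: "('a, 'b) tensor" assume "a \<in> free_lie" "b \<in> free_lie"
  then show "D (D' (commutator a b)) - D' (D (commutator a b)) =
      commutator (D (D' a) - D' (D a)) b + commutator a (D (D' b) - D' (D b))"
    by (simp add: derivation_commutator[OF D] derivation_commutator[OF D'] derivation_add[OF D]
        derivation_add[OF D'] derivation_closed[OF D] derivation_closed[OF D'] free_lie_commutator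
        tlinear_diff[OF tlinear_commutator_left[OF tlinear_id]]
        tlinear_diff[OF tlinear_commutator_right[OF tlinear_id]])
qed (simp_all add: D D' derivation_closed derivation_outside derivation_zero derivation_add
      derivation_scale free_lie_diff tscale_diff)

lemma is_derivation_sum: "(\<And>x. x \<in> A \<Longrightarrow> is_derivation (D x)) \<Longrightarrow> is_derivation (sum D A)"
  by (induction A rule: infinite_finite_induct) (simp_all add: is_derivation_zero is_derivation_add)

lemma sum_fun_apply: "sum f A x = (\<Sum>y\<in>A. f y x)"
  by (induction A rule: infinite_finite_induct) simp_all

section \<open>Homogeneous derivations\<close>

lemma Der_derivation: "\<theta> \<in> Der q \<Longrightarrow> is_derivation \<theta>"
  and Der_gen: "\<theta> \<in> Der q \<Longrightarrow> \<theta> (gen i) \<in> free_lie_comp q"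
  by (simp_all add: Der_def)

lemma Der_zero: "0 \<in> Der q"
  by (simp add: Der_def is_derivation_zero)

lemma Der_add: "\<theta> \<in> Der q \<Longrightarrow> \<theta>' \<in> Der q \<Longrightarrow> \<theta> + \<theta>' \<in> Der q"
  by (simp add: Der_def is_derivation_add free_lie_comp_add)

lemma Der_scale: "\<theta> \<in> Der q \<Longrightarrow> der_scale c \<theta> \<in> Der q"
  using is_derivation_scale[of \<theta> c] by (simp add: Der_def der_scale_def free_lie_comp_scale)

lemma Der_uminus: "\<theta> \<in> Der q \<Longrightarrow> - \<theta> \<in> Der q"
  by (simp add: uminus_eq_der_scale Der_scale)

text \<open>One letter is replaced by a bracket of \<open>d + 1\<close> letters, so the length grows
  by \<open>d\<close>. Hence the index shift, here and for brackets of derivations.\<close>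

lemma Der_free_lie_comp:
  assumes "\<theta> \<in> Der (Suc d)" "a \<in> free_lie_comp q"
  shows "\<theta> a \<in> free_lie_comp (q + d)"
proof -
  have D: "is_derivation \<theta>" using assms(1) by (rule Der_derivation)
  have in_free_lie: "a \<in> free_lie" if "has_bracket_length p a" for p and a :: "('a, 'b) tensor"
    using that free_lie_comp_free_lie[of p] by (auto simp: free_lie_comp_def)
  have "has_bracket_length q a" using assms(2) by (simp add: free_lie_comp_def)
  then show ?thesis
  proof induction
    case (gen i)
    show ?case using Der_gen[OF assms(1)] by simp
  next
    case (bracket p a q b)
    have "a \<in> free_lie_comp p" "b \<in> free_lie_comp q"
      using bracket by (simp_all add: free_lie_comp_def)
    then have "commutator (\<theta> a) b \<in> free_lie_comp (p + d + q)"
      "commutator a (\<theta> b) \<in> free_lie_comp (p + (q + d))"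
      using bracket.IH by (simp_all add: free_lie_comp_commutator)
    then show ?case
      by (simp add: derivation_commutator[OF D] in_free_lie[OF bracket.hyps(1)]
          in_free_lie[OF bracket.hyps(2)] free_lie_comp_add ac_simps)
  qed (simp_all add: derivation_zero[OF D] derivation_add[OF D] derivation_scale[OF D] in_free_lie
        free_lie_comp_add free_lie_comp_scale)
qed

lemma Der_bracket:
  assumes "\<theta> \<in> Der (Suc d)" "\<theta>' \<in> Der (Suc e)"
  shows "der_bracket \<theta> \<theta>' \<in> Der (Suc (d + e))"
proof -
  have "\<theta> (\<theta>' (gen i)) \<in> free_lie_comp (Suc e + d)" "\<theta>' (\<theta> (gen i)) \<in> free_lie_comp (Suc d + e)" for i
    using assms by (blast intro: Der_free_lie_comp Der_gen)+
  then have "\<theta> (\<theta>' (gen i)) - \<theta>' (\<theta> (gen i)) \<in> free_lie_comp (Suc (d + e))" for i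
    by (simp add: add.commute tsubmodule_diff)
  moreover have "is_derivation (der_bracket \<theta> \<theta>')"
    using assms by (intro is_derivation_bracket Der_derivation)
  ultimately show ?thesis by (simp add: Der_def der_bracket_def)
qed

section \<open>The action of the Schur algebras on derivations\<close>

lemma Phi_gen_comp: "f \<in> schur_carrier q \<Longrightarrow> \<theta> \<in> Der q \<Longrightarrow> f (\<theta> (gen i)) \<in> free_lie_comp q"
  by (rule schur_free_lie_comp[OF _ Der_gen])

lemma
  assumes f: "f \<in> schur_carrier q" and \<theta>: "\<theta> \<in> Der q"
  shows is_derivation_Phi: "is_derivation (Phi f \<theta>)" and Phi_gen: "Phi f \<theta> (gen i) = f (\<theta> (gen i))"
proof -
  have closed: "f (\<theta> (gen i)) \<in> free_lie" for i
    using Phi_gen_comp[OF assms] by (rule subsetD[OF free_lie_comp_free_lie])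
  show "is_derivation (Phi f \<theta>)"
    unfolding Phi_def by (rule is_derivation_der_of[OF closed])
  show "Phi f \<theta> (gen i) = f (\<theta> (gen i))"
    unfolding Phi_def by (rule der_of_gen[of "\<lambda>i. f (\<theta> (gen i))", OF closed])
qed

lemma Phi_Der:
  assumes "f \<in> schur_carrier q" "\<theta> \<in> Der q"
  shows "Phi f \<theta> \<in> Der q"
  unfolding Der_def mem_Collect_eq Phi_gen[OF assms]
  using is_derivation_Phi[OF assms] Phi_gen_comp[OF assms] by blast

lemma Phi_eqI:
  "is_derivation D \<Longrightarrow> (\<And>i. f (\<theta> (gen i)) = D (gen i)) \<Longrightarrow> Phi f \<theta> = D"
  unfolding Phi_def by (rule der_of_eqI) simp_all

lemma Der_gen_tensor_power: "\<theta> \<in> Der q \<Longrightarrow> \<theta> (gen i) \<in> tensor_power q"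
  by (rule subsetD[OF free_lie_comp_tensor_power Der_gen])

text \<open>By uniqueness every module law may be checked at the generators, where
  \<open>Phi f\<close> is application of \<open>f\<close> to elements of the tensor power.\<close>

lemma left_module_Der:
  "left_module (Schur q) (module_on (Der q)
    (Phi :: (('n, 'k::{comm_ring, comm_monoid_mult}) tensor \<Rightarrow> ('n, 'k) tensor) \<Rightarrow> _))"
proof (rule left_module_onI)
  fix f g x :: "('n, 'k) tensor \<Rightarrow> ('n, 'k) tensor"
  assume f: "f \<in> schur_carrier q" and g: "g \<in> schur_carrier q" and x: "x \<in> Der q"
  show "Phi (\<lambda>a. f a + g a) x = Phi f x + Phi g x"
    using f g x
    by (intro Phi_eqI is_derivation_add) (auto simp: Phi_gen intro: Phi_Der Der_derivation)
  show "Phi (f \<circ> g) x = Phi f (Phi g x)"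
    using f g x by (intro Phi_eqI) (auto simp: Phi_gen Phi_Der intro: Phi_Der Der_derivation)
next
  fix f x y :: "('n, 'k) tensor \<Rightarrow> ('n, 'k) tensor"
  assume f: "f \<in> schur_carrier q" and x: "x \<in> Der q" and y: "y \<in> Der q"
  show "Phi f (x + y) = Phi f x + Phi f y"
    using f x y
    by (intro Phi_eqI is_derivation_add)
      (auto simp: Phi_gen schur_add Der_gen_tensor_power intro: Phi_Der Der_derivation)
next
  fix x :: "('n, 'k) tensor \<Rightarrow> ('n, 'k) tensor"
  assume "x \<in> Der q"
  then show "Phi (\<lambda>a. if a \<in> tensor_power q then a else 0) x = x"
    by (intro Phi_eqI) (auto simp: Der_gen_tensor_power intro: Der_derivation)
qed (simp_all add: Der_zero Der_add Der_uminus Phi_Der)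

section \<open>The actions of the Schur operad\<close>

lemma is_internal_direct_sum_tensor:
  assumes "A = sum_of_components I C" and C: "\<And>q. C q \<subseteq> tensor_power q"
  shows "is_internal_direct_sum A I C"
  unfolding is_internal_direct_sum_def
proof (intro conjI allI impI ballI; (elim conjE)?)
  fix F a q
  assume F: "finite F" "q \<in> F" and a: "\<forall>q\<in>F. a q \<in> C q" and sum: "sum a F = 0"
  show "a q = 0"
    by (rule homog_independent[OF F(1) _ sum F(2)]) (use a C in auto)
qed (rule assms(1))

lemma acts_on_tensor_algebra:
  "schur_operad_acts_on UNIV UNIV tensor_power tscale (\<lambda>(f :: ('n, 'k) tensor \<Rightarrow> ('n, 'k) tensor) a. f a
    :: ('n, 'k::{comm_ring, comm_monoid_mult}) tensor)"
  unfolding schur_operad_acts_on_def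
proof (intro conjI ballI allI)
  have "a \<in> sum_of_components UNIV tensor_power" for a :: "('n, 'k) tensor"
  proof -
    let ?N = "sum_of_components UNIV tensor_power :: ('n, 'k) tensor set"
    have comp: "tscale c (word w) \<in> ?N" for w :: "'n list" and c :: 'k
      by (rule sum_of_components_incl[of "length w"])
        (simp_all add: tensor_power_scale word_in_tensor_power)
    have "(\<Sum>w\<in>A. tscale (Poly_Mapping.lookup a w) (word w)) \<in> ?N" for A
      by (induction A rule: infinite_finite_induct)
        (simp_all add: sum_of_components_zero sum_of_components_add comp tensor_power_add)
    from this[of "Poly_Mapping.keys a"] show ?thesis
      by (simp only: word_expansion[symmetric])
  qed
  then show "is_internal_direct_sum UNIV UNIV (tensor_power :: nat \<Rightarrow> ('n, 'k) tensor set)"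
    by (intro is_internal_direct_sum_tensor) auto
next
  fix q :: nat
  show "left_module (schur_operad (q + 1)) (module_on (tensor_power q :: ('n, 'k) tensor set) (\<lambda>f. f))"
    unfolding schur_operad_def add_diff_cancel_right'
    by (rule left_module_onI)
      (simp_all add: tensor_power_add tensor_power_uminus schur_closed schur_add)
qed (simp_all add: schur_operad_def schur_carrier_scale)

lemma acts_on_free_lie:
  "schur_operad_acts_on free_lie {1..} free_lie_comp tscale
    (\<lambda>(f :: ('n, 'k) tensor \<Rightarrow> ('n, 'k) tensor) a. f a :: ('n, 'k::{comm_ring, comm_monoid_mult}) tensor)"
  unfolding schur_operad_acts_on_def
proof (intro conjI ballI allI)
  show "is_internal_direct_sum free_lie {1..} (free_lie_comp :: nat \<Rightarrow> ('n, 'k) tensor set)"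
    by (intro is_internal_direct_sum_tensor free_lie_eq free_lie_comp_tensor_power)
next
  fix q :: nat
  show "left_module (schur_operad (q + 1)) (module_on (free_lie_comp q :: ('n, 'k) tensor set) (\<lambda>f. f))"
    unfolding schur_operad_def add_diff_cancel_right'
    by (rule left_module_onI)
      (use free_lie_comp_tensor_power in \<open>auto simp: free_lie_comp_add tsubmodule_uminus
        schur_free_lie_comp intro!: schur_add\<close>)
qed (simp_all add: schur_operad_def schur_carrier_scale)

text \<open>An arbitrary \<open>I\<close> covers \<open>Der_triangle\<close> and
  \<open>Der_star\<close> at once. The sum is direct because the values at a generator lie in
  different tensor powers.\<close>

lemma acts_on_Der:
  "schur_operad_acts_on (sum_of_components I Der) I Der der_scale
    (Phi :: (('n, 'k::{comm_ring, comm_monoid_mult}) tensor \<Rightarrow> ('n, 'k) tensor) \<Rightarrow> _)"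
  unfolding schur_operad_acts_on_def
proof (intro conjI ballI allI)
  show "is_internal_direct_sum (sum_of_components I Der) I
    (Der :: nat \<Rightarrow> (('n, 'k) tensor \<Rightarrow> ('n, 'k) tensor) set)"
    unfolding is_internal_direct_sum_def
  proof (intro conjI allI impI ballI; (elim conjE)?)
    fix F q and \<theta> :: "nat \<Rightarrow> ('n, 'k) tensor \<Rightarrow> ('n, 'k) tensor"
    assume F: "finite F" "q \<in> F" and \<theta>: "\<forall>q\<in>F. \<theta> q \<in> Der q" and sum: "sum \<theta> F = 0"
    have "\<theta> q (gen i) = 0" for i
    proof (rule homog_independent[OF F(1) _ _ F(2)])
      show "(\<Sum>q\<in>F. \<theta> q (gen i)) = 0"
        using fun_cong[OF sum, of "gen i"] by (simp add: sum_fun_apply)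
    qed (use \<theta> in \<open>auto intro: Der_gen_tensor_power\<close>)
    then show "\<theta> q = 0"
      using \<theta> F(2) by (intro derivation_eqI[OF _ is_derivation_zero]) (auto intro: Der_derivation)
  qed simp
next
  fix q
  show "left_module (schur_operad (q + 1)) (module_on (Der q)
    (Phi :: (('n, 'k) tensor \<Rightarrow> ('n, 'k) tensor) \<Rightarrow> _))"
    using left_module_Der by (simp add: schur_operad_def)
next
  fix q c and f \<theta> :: "('n, 'k) tensor \<Rightarrow> ('n, 'k) tensor"
  assume f: "f \<in> carrier (schur_operad (q + 1))" and \<theta>: "\<theta> \<in> Der q"
  then show "Phi (\<lambda>a. tscale c (f a)) \<theta> = der_scale c (Phi f \<theta>)"
    by (intro Phi_eqI is_derivation_scale)
      (auto simp: schur_operad_def der_scale_def Phi_gen intro: Phi_Der Der_derivation)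
qed (simp add: schur_operad_def schur_carrier_scale)

section \<open>Generation\<close>

definition letter_map :: "('n \<Rightarrow> 'n) \<Rightarrow> ('n, 'k::{comm_ring, comm_monoid_mult}) tensor \<Rightarrow> ('n, 'k) tensor" where
  "letter_map \<pi> = linear_ext (\<lambda>w. word (map \<pi> w))"

lemma tlinear_letter_map [simp]: "tlinear (letter_map \<pi>)"
  by (simp add: letter_map_def)

lemma letter_map_mult: "letter_map \<pi> (a * b) = letter_map \<pi> a * letter_map \<pi> b"
proof (rule tlinear_eqI[of "\<lambda>a. letter_map \<pi> (a * b)" "\<lambda>a. letter_map \<pi> a * letter_map \<pi> b"])
  fix v
  show "letter_map \<pi> (word v * b) = letter_map \<pi> (word v) * letter_map \<pi> b"
    by (rule tlinear_eqI[of "\<lambda>b. letter_map \<pi> (word v * b)"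
          "\<lambda>b. letter_map \<pi> (word v) * letter_map \<pi> b"])
      (simp_all add: letter_map_def word_mult tlinear_mult_left tlinear_id
        tlinear_compose[of "linear_ext _" "\<lambda>b. word v * b"])
qed (simp_all add: letter_map_def tlinear_mult_right tlinear_id
      tlinear_compose[of "linear_ext _" "\<lambda>a. a * b"])

lemma letter_map_commutator:
  "letter_map \<pi> (commutator a b) = commutator (letter_map \<pi> a) (letter_map \<pi> b)"
  by (simp add: commutator_def letter_map_mult tlinear_diff)

lemma letter_map_gen [simp]: "letter_map \<pi> (gen i) = gen (\<pi> i)"
  by (simp add: letter_map_def gen_eq_word)

lemma letter_map_left_normed [simp]: "letter_map \<pi> (left_normed w) = left_normed (map \<pi> w)"
proof (induction w rule: left_normed.induct)
  case 1
  then show ?case using tlinear_zero[OF tlinear_linear_ext] by (simp add: letter_map_def)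
qed (simp_all add: letter_map_commutator)

lemma left_normed_homog_mset: "left_normed w \<in> homog mset (mset w)"
proof (induction w rule: left_normed.induct)
  case (2 i)
  then show ?case using word_in_homog[of "[i]" mset] by (simp add: gen_eq_word)
next
  case (3 i j w)
  then show ?case
    using homog_commutator[of mset "left_normed (j # w)" "mset (j # w)" "gen i" "{#i#}"]
      word_in_homog[of "[i]" mset]
    by (simp add: gen_eq_word)
qed (simp add: tsubmodule_zero)

text \<open>The projection onto the weight space of \<open>M\<close>, followed by the substitution
  \<open>\<pi>\<close>, which may identify letters.\<close>

definition weight_map ::
    "'n multiset \<Rightarrow> ('n \<Rightarrow> 'n) \<Rightarrow> ('n, 'k::{comm_ring, comm_monoid_mult}) tensor \<Rightarrow> ('n, 'k) tensor" where
  "weight_map M \<pi> = (\<lambda>a. if a \<in> tensor_power (size M)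
    then linear_ext (\<lambda>w. if mset w = M then word (map \<pi> w) else 0) a else 0)"

text \<open>Permuting places preserves the multiset of letters and commutes with replacing letters
  one by one.\<close>

lemma weight_map_schur: "weight_map M \<pi> \<in> schur_carrier (size M)"
  unfolding weight_map_def
proof (rule schur_carrier_cutoff)
  fix w :: "'a list" and \<sigma>
  assume w: "length w = size M" and "\<sigma> permutes {..<size M}"
  then have inv: "inv_into UNIV \<sigma> permutes {..<length w}" by (simp add: permutes_inv)
  show "(if mset (permute_list (inv_into UNIV \<sigma>) w) = M
      then word (map \<pi> (permute_list (inv_into UNIV \<sigma>) w)) else 0) =
    perm_act \<sigma> (if mset w = M then word (map \<pi> w) else 0)"
    using inv by (simp add: permute_list_map tlinear_zero)
qed (simp add: word_in_tensor_power)

lemma homog_mset_tensor_power: "homog mset M \<subseteq> tensor_power (size M)"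
  by (auto simp: homog_def tensor_power_def)

lemma weight_map_same:
  assumes "a \<in> homog mset M"
  shows "weight_map M \<pi> a = letter_map \<pi> a"
proof -
  have "linear_ext (\<lambda>w. if mset w = M then word (map \<pi> w) else 0) a = letter_map \<pi> a"
    unfolding letter_map_def
    by (rule tlinear_eq_homog[OF tlinear_linear_ext tlinear_linear_ext assms]) simp
  then show ?thesis using assms homog_mset_tensor_power by (auto simp: weight_map_def)
qed

lemma weight_map_other:
  assumes "a \<in> homog mset M'" "M' \<noteq> M"
  shows "weight_map M \<pi> a = 0"
  using linear_ext_homog[of "{0}" a mset M' "\<lambda>w. if mset w = M then word (map \<pi> w) else 0"] assms
  by (simp add: weight_map_def tsubmodule_def)

text \<open>The common form of \<open>chi\<close> and \<open>theta\<close>. As there are finitely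
  many generators, every derivation is a sum of such ones.\<close>

definition single_der ::
    "'n \<Rightarrow> ('n, 'k::{comm_ring, comm_monoid_mult}) tensor \<Rightarrow> (('n, 'k) tensor \<Rightarrow> ('n, 'k) tensor)" where
  "single_der i a = der_of (\<lambda>k. if k = i then a else 0)"

lemma chi_eq: "chi i j = single_der i (commutator (gen i) (gen j))"
  and theta_eq: "theta i s t = single_der i (commutator (gen s) (gen t))"
  by (simp_all add: chi_def theta_def single_der_def)

lemma is_derivation_single_der: "a \<in> free_lie \<Longrightarrow> is_derivation (single_der i a)"
  unfolding single_der_def by (rule is_derivation_der_of) simp

lemma single_der_gen: "a \<in> free_lie \<Longrightarrow> single_der i a (gen k) = (if k = i then a else 0)"
  unfolding single_der_def by (simp add: der_of_gen)

lemma single_der_Der: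
  assumes "a \<in> free_lie_comp q"
  shows "single_der i a \<in> Der q"
proof -
  have "a \<in> free_lie" using assms free_lie_comp_free_lie by blast
  then show ?thesis
    using assms by (simp add: Der_def is_derivation_single_der single_der_gen)
qed

lemma gen_comp: "gen i \<in> free_lie_comp 1"
  using has_bracket_length.gen by (auto simp: free_lie_comp_def)

lemma commutator_gen_comp: "commutator (gen i) (gen j) \<in> free_lie_comp 2"
  using free_lie_comp_commutator[OF gen_comp gen_comp, of i j] by (simp add: numeral_2_eq_2)

lemma commutator_gen_free_lie: "commutator (gen i) (gen j) \<in> free_lie"
  by (simp add: free_lie_commutator)

lemma gen_homog_mset: "gen i \<in> homog mset {#i#}"
  using word_in_homog[of "[i]" mset] by (simp add: gen_eq_word)

lemma commutator_gen_homog_mset: "commutator (gen i) (gen j) \<in> homog mset {#i, j#}"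
  using homog_commutator[OF _ gen_homog_mset gen_homog_mset, of i j] by (simp add: add_mset_commute)

lemma left_normed_free_lie [simp]: "left_normed w \<in> free_lie"
  using left_normed_comp[of w] free_lie_comp_free_lie by blast

section \<open>\<open>Der_star\<close> is closed under all operations\<close>

lemma Der_star_zero: "0 \<in> Der_star"
  unfolding Der_star_def by (rule sum_of_components_zero)

lemma Der_star_add: "x \<in> Der_star \<Longrightarrow> y \<in> Der_star \<Longrightarrow> x + y \<in> Der_star"
  unfolding Der_star_def by (rule sum_of_components_add) (simp_all add: Der_zero Der_add)

lemma Der_star_incl: "2 \<le> q \<Longrightarrow> x \<in> Der q \<Longrightarrow> x \<in> Der_star"
  unfolding Der_star_def by (rule sum_of_components_incl[of q]) simp_all

text \<open>Membership in \<open>Der_star\<close> is kept in the sum case, since additivity of the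
  bracket is available for derivations only.\<close>

lemma Der_star_induct [consumes 1, case_names zero comp add]:
  fixes x :: "('n, 'k::{comm_ring, comm_monoid_mult}) tensor \<Rightarrow> ('n, 'k) tensor"
  assumes "x \<in> Der_star" "P 0" "\<And>q x. 2 \<le> q \<Longrightarrow> x \<in> Der q \<Longrightarrow> P x"
    "\<And>x y. x \<in> Der_star \<Longrightarrow> y \<in> Der_star \<Longrightarrow> P x \<Longrightarrow> P y \<Longrightarrow> P (x + y)"
  shows "P x"
proof -
  have "x \<in> Der_star \<and> P x"
    using assms(1)[unfolded Der_star_def]
  proof (rule sum_of_components_induct)
    show "0 \<in> Der_star \<and> P 0" using assms(2) Der_star_zero by blast
  next
    fix q and x :: "('n, 'k) tensor \<Rightarrow> ('n, 'k) tensor"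
    assume "q \<in> {2..}" "x \<in> Der q"
    then show "x \<in> Der_star \<and> P x" using assms(3)[of q x] Der_star_incl[of q x] by simp
  next
    fix x y :: "('n, 'k) tensor \<Rightarrow> ('n, 'k) tensor"
    assume "x \<in> Der_star \<and> P x" "y \<in> Der_star \<and> P y"
    then show "x + y \<in> Der_star \<and> P (x + y)" using assms(4)[of x y] Der_star_add[of x y] by blast
  qed
  then show ?thesis ..
qed

lemma Der_star_derivation: "x \<in> Der_star \<Longrightarrow> is_derivation x"
proof (induction rule: Der_star_induct)
  case zero show "is_derivation 0" by (rule is_derivation_zero)
next
  case (comp q x) then show ?case by (intro Der_derivation)
next
  case (add x y) then show "is_derivation (x + y)" by (intro is_derivation_add)
qed

lemma Der_star_scale:
  fixes x :: "('n, 'k::{comm_ring, comm_monoid_mult}) tensor \<Rightarrow> ('n, 'k) tensor"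
  assumes "x \<in> Der_star"
  shows "der_scale c x \<in> Der_star"
  using assms
proof (induction rule: Der_star_induct)
  case zero
  have "der_scale c 0 = (0 :: ('n, 'k) tensor \<Rightarrow> ('n, 'k) tensor)" by (simp add: der_scale_def fun_eq_iff)
  then show "der_scale c (0 :: ('n, 'k) tensor \<Rightarrow> ('n, 'k) tensor) \<in> Der_star" by (simp add: Der_star_zero)
next
  case (comp q x)
  then show ?case by (intro Der_star_incl[of q] Der_scale)
next
  case (add x y)
  have "der_scale c (x + y) = der_scale c x + der_scale c y"
    by (simp add: der_scale_def fun_eq_iff tscale_right_distrib)
  with add show "der_scale c (x + y) \<in> Der_star" by (simp add: Der_star_add)
qed

lemma der_bracket_add_left:
  "is_derivation x \<Longrightarrow> is_derivation y \<Longrightarrow> is_derivation z \<Longrightarrow>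
    der_bracket (x + y) z = der_bracket x z + der_bracket y z"
  by (simp add: der_bracket_def fun_eq_iff derivation_add derivation_closed)

lemma der_bracket_add_right:
  "is_derivation x \<Longrightarrow> is_derivation y \<Longrightarrow> is_derivation z \<Longrightarrow>
    der_bracket z (x + y) = der_bracket z x + der_bracket z y"
  by (simp add: der_bracket_def fun_eq_iff derivation_add derivation_closed)

lemma Der_star_bracket:
  assumes "x \<in> Der_star" and y: "y \<in> Der_star"
  shows "der_bracket x y \<in> Der_star"
  using assms(1)
proof (induction rule: Der_star_induct)
  case zero
  have "der_bracket 0 y = 0"
    by (simp add: der_bracket_def fun_eq_iff derivation_zero Der_star_derivation[OF y])
  then show "der_bracket 0 y \<in> Der_star" by (simp add: Der_star_zero)
next
  case (comp p x)
  show ?case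
    using y
  proof (induction rule: Der_star_induct)
    case zero
    have "der_bracket x 0 = 0"
      using comp by (simp add: der_bracket_def fun_eq_iff derivation_zero[OF Der_derivation])
    then show "der_bracket x 0 \<in> Der_star" by (simp add: Der_star_zero)
  next
    case (comp q y)
    \<comment> \<open>The bracket has degree \<open>Suc (d + e)\<close>; positivity of
      \<open>d\<close> and \<open>e\<close> keeps it at 2 or more.\<close>
    obtain d e where "p = Suc d" "q = Suc e" "1 \<le> d" "1 \<le> e"
      using \<open>2 \<le> p\<close> \<open>2 \<le> q\<close> by (cases p; cases q) auto
    then show ?case
      using Der_bracket[of x d y e] \<open>x \<in> Der p\<close> \<open>y \<in> Der q\<close>
      by (intro Der_star_incl[of "Suc (d + e)"]) auto
  next
    case (add y y')
    then show "der_bracket x (y + y') \<in> Der_star"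
      using \<open>x \<in> Der p\<close>
      by (simp add: der_bracket_add_right Der_star_derivation Der_derivation Der_star_add)
  qed
next
  case (add x x')
  then show "der_bracket (x + x') y \<in> Der_star"
    using y by (simp add: der_bracket_add_left Der_star_derivation Der_star_add)
qed

lemma schur_lie_subalgebra_Der_star: "schur_lie_subalgebra Der_star"
  unfolding schur_lie_subalgebra_def lie_subalgebra_def
proof (intro conjI allI impI ballI)
  fix q :: nat and f :: "('a, 'b) tensor \<Rightarrow> ('a, 'b) tensor"
  assume "2 \<le> q" "f \<in> carrier (Schur q)"
  then show "Phi f ` (Der_star \<inter> Der q) \<subseteq> Der_star"
    using Der_star_incl[OF _ Phi_Der] by auto
qed (simp_all add: Der_star_zero Der_star_add Der_star_scale Der_star_bracket)

section \<open>Lie subalgebras closed under the Schur action\<close>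

context
  fixes S :: "(('n::finite, 'k::{comm_ring, comm_monoid_mult}) tensor \<Rightarrow> ('n, 'k) tensor) set"
  assumes S: "schur_lie_subalgebra S"
begin

lemma closed_zero: "0 \<in> S"
  and closed_add: "x \<in> S \<Longrightarrow> y \<in> S \<Longrightarrow> x + y \<in> S"
  and closed_scale: "x \<in> S \<Longrightarrow> der_scale c x \<in> S"
  and closed_bracket: "x \<in> S \<Longrightarrow> y \<in> S \<Longrightarrow> der_bracket x y \<in> S"
  using S by (auto simp: schur_lie_subalgebra_def lie_subalgebra_def)

lemma closed_Phi: "2 \<le> q \<Longrightarrow> f \<in> schur_carrier q \<Longrightarrow> x \<in> S \<Longrightarrow> x \<in> Der q \<Longrightarrow> Phi f x \<in> S"
  using S unfolding schur_lie_subalgebra_def carrier_Schur by blast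

lemma closed_sum: "(\<And>x. x \<in> A \<Longrightarrow> f x \<in> S) \<Longrightarrow> sum f A \<in> S"
  by (induction A rule: infinite_finite_induct) (simp_all add: closed_zero closed_add)

text \<open>A derivation is the sum of its parts supported at single generators, and for fixed
  \<open>j\<close> the admissible values at \<open>x_j\<close> form a submodule; so left-normed
  brackets suffice.\<close>

lemma Der_subset_closed:
  assumes "\<And>j w. length w = q \<Longrightarrow> single_der j (left_normed w) \<in> S"
  shows "Der q \<subseteq> S"
proof
  fix \<theta> :: "('n, 'k) tensor \<Rightarrow> ('n, 'k) tensor"
  assume \<theta>: "\<theta> \<in> Der q"
  have single: "single_der j a \<in> S" if a: "a \<in> free_lie_comp q" for j and a :: "('n, 'k) tensor"
  proof -
    \<comment> \<open>Restricted to \<open>free_lie\<close>, because \<open>der_of\<close> is a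
      meaningful derivation only for values there.\<close>
    let ?N = "{a \<in> free_lie. single_der j a \<in> S}"
    have "single_der j (0 :: ('n, 'k) tensor) = 0"
      by (rule derivation_eqI)
        (simp_all add: is_derivation_single_der is_derivation_zero single_der_gen)
    moreover have "single_der j (a + b) = single_der j a + single_der j b"
      if "a \<in> free_lie" "b \<in> free_lie" for a b :: "('n, 'k) tensor"
      by (rule derivation_eqI)
        (simp_all add: that is_derivation_single_der is_derivation_add single_der_gen free_lie_add)
    moreover have "single_der j (tscale c a) = der_scale c (single_der j a)"
      if "a \<in> free_lie" for c and a :: "('n, 'k) tensor"
      by (rule derivation_eqI, simp_all add: that is_derivation_single_der is_derivation_scale free_lie_scale)
        (simp_all add: that der_scale_def single_der_gen free_lie_scale)
    ultimately have N: "tsubmodule ?N"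
      by (simp add: tsubmodule_def closed_zero closed_add closed_scale free_lie_add free_lie_scale)
    obtain t :: "('n, 'k) tensor" where t: "a = linear_ext left_normed t" "t \<in> tensor_power q"
      using a unfolding free_lie_comp_eq by (rule imageE)
    have "linear_ext left_normed t \<in> ?N"
      by (rule linear_ext_homog[OF N t(2)[unfolded tensor_power_eq_homog]]) (simp add: assms)
    then show ?thesis by (simp add: t)
  qed
  have comp: "\<theta> (gen j) \<in> free_lie" for j
    using \<theta> by (intro derivation_closed Der_derivation)
  have "\<theta> = (\<Sum>j\<in>UNIV. single_der j (\<theta> (gen j)))"
    by (rule derivation_eqI)
      (simp_all add: \<theta>[THEN Der_derivation] is_derivation_sum is_derivation_single_der comp
        sum_fun_apply single_der_gen)
  also have "\<dots> \<in> S" using single \<theta> by (intro closed_sum) (auto intro: Der_gen)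
  finally show "\<theta> \<in> S" .
qed

text \<open>As \<open>s\<close> and \<open>t\<close> differ, their images under a substitution can
  be prescribed independently, so \<open>[x_s, x_t]\<close> is carried to any bracket of two
  generators, while the value 0 at the other generators stays 0.\<close>

lemma Der_2_subset_closed:
  assumes "\<And>j. \<exists>s t. s \<noteq> t \<and> single_der j (commutator (gen s) (gen t)) \<in> S"
  shows "Der 2 \<subseteq> S"
proof (rule Der_subset_closed)
  fix j :: 'n and w :: "'n list"
  assume "length w = 2"
  \<comment> \<open>The first letter of the word is the right argument of the bracket, hence the
    reversed order.\<close>
  then obtain s' t' where w: "w = [t', s']"
    by (auto simp: numeral_2_eq_2 length_Suc_conv)
  obtain s t where st: "s \<noteq> t" "single_der j (commutator (gen s) (gen t)) \<in> S"
    using assms by blast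
  define \<pi> where "\<pi> k = (if k = s then s' else t')" for k
  let ?f = "weight_map {#s, t#} \<pi> :: ('n, 'k) tensor \<Rightarrow> ('n, 'k) tensor"
  have f: "?f \<in> schur_carrier 2" using weight_map_schur[of "{#s, t#}" \<pi>] by (simp add: numeral_2_eq_2)
  have f_val: "?f (commutator (gen s) (gen t)) = commutator (gen s') (gen t')"
    using st(1) by (simp add: weight_map_same commutator_gen_homog_mset letter_map_commutator \<pi>_def)
  have "Phi ?f (single_der j (commutator (gen s) (gen t))) = single_der j (left_normed w)"
    by (rule Phi_eqI)
      (simp_all add: w is_derivation_single_der single_der_gen commutator_gen_free_lie f_val schur_zero[OF f])
  then show "single_der j (left_normed w) \<in> S"
    using closed_Phi[OF _ f st(2)] by (simp add: single_der_Der commutator_gen_comp)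
qed

text \<open>
  The value at \<open>x\<^sub>j\<close> of the bracket of \<open>x\<^sub>i \<mapsto> a\<close> with \<open>x\<^sub>j \<mapsto> [x\<^sub>i, x\<^sub>j]\<close> is \<open>[a, x\<^sub>j]\<close>; its value at
  \<open>x\<^sub>i\<close> has a different weight, hence is killed by a projection in the Schur algebra.  The letter
  \<open>x\<^sub>j\<close> in \<open>[a, x\<^sub>j]\<close> can then be exchanged for any other one.
\<close>

lemma Der_Suc_subset_closed:
  assumes other: "\<And>j :: 'n. \<exists>i. i \<noteq> j" and "2 \<le> q" "Der 2 \<subseteq> S" "Der q \<subseteq> S"
  shows "Der (Suc q) \<subseteq> S"
proof (rule Der_subset_closed)
  fix j :: 'n and w :: "'n list"
  assume "length w = Suc q"
  then obtain s v where w: "w = s # v" and v: "length v = q" by (auto simp: length_Suc_conv)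
  have v_ne: "v \<noteq> []" using v \<open>2 \<le> q\<close> by auto
  obtain i where ij: "i \<noteq> j" using other by blast
  \<comment> \<open>The transposition of \<open>j\<close> and \<open>s\<close>. The letter
    \<open>j\<close> in \<open>[a, x_j]\<close> is to become \<open>s\<close>, and the substitution
    acts on \<open>a\<close> too; \<open>a\<close> is therefore built from the word \<open>v\<close>
    with \<open>\<pi>\<close> already applied, which the second application undoes.\<close>
  define \<pi> where "\<pi> k = (if k = j then s else if k = s then j else k)" for k
  have invol: "\<pi> (\<pi> k) = k" for k by (simp add: \<pi>_def)
  define a :: "('n, 'k) tensor" where "a = left_normed (map \<pi> v)"
  define b :: "('n, 'k) tensor" where "b = commutator (gen i) (gen j)"
  define M where "M = mset (map \<pi> v)"
  have a: "a \<in> free_lie" "a \<in> free_lie_comp q" "a \<in> homog mset M"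
    using left_normed_comp[of "map \<pi> v" q] left_normed_homog_mset[of "map \<pi> v"] v
    by (simp_all add: a_def M_def)
  have b: "b \<in> free_lie" "b \<in> free_lie_comp 2"
    by (simp_all add: b_def commutator_gen_free_lie commutator_gen_comp)
  define \<theta> where "\<theta> = single_der i a"
  define \<eta> where "\<eta> = single_der j b"
  note D = is_derivation_single_der[OF a(1), of i, folded \<theta>_def]
    is_derivation_single_der[OF b(1), of j, folded \<eta>_def]
  note gens = single_der_gen[OF a(1), of i, folded \<theta>_def] single_der_gen[OF b(1), of j, folded \<eta>_def]
  have \<theta>: "\<theta> \<in> Der q" and \<eta>: "\<eta> \<in> Der 2"
    unfolding \<theta>_def \<eta>_def by (rule single_der_Der[OF a(2)], rule single_der_Der[OF b(2)])
  have bracket: "der_bracket \<theta> \<eta> \<in> S" "der_bracket \<theta> \<eta> \<in> Der (Suc q)"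
    using closed_bracket[OF subsetD[OF assms(4) \<theta>] subsetD[OF assms(3) \<eta>]]
      Der_bracket[of \<theta> "q - 1" \<eta> 1] \<theta> \<eta> \<open>2 \<le> q\<close>
    by (simp_all add: numeral_2_eq_2)
  let ?f = "weight_map (add_mset j M) \<pi> :: ('n, 'k) tensor \<Rightarrow> ('n, 'k) tensor"
  have f: "?f \<in> schur_carrier (Suc q)"
    using weight_map_schur[of "add_mset j M" \<pi>] v by (simp add: M_def)
  \<comment> \<open>The value of \<open>der_bracket \<theta> \<eta>\<close> at \<open>x_i\<close> is
    \<open>- \<eta> a\<close>: in it one letter \<open>j\<close> of \<open>a\<close> becomes
    \<open>[x_i, x_j]\<close>, which adds \<open>i\<close> to the weight.\<close>
  have "\<eta> a = tensor_deriv (\<lambda>k. if k = j then b else 0) a"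
    unfolding \<eta>_def single_der_def using a(1) b(1) by (simp add: der_of_eq)
  also have "\<dots> \<in> homog mset (M + {#i#})"
  proof (rule tensor_deriv_homog_mset[OF _ a(3)])
    fix k
    show "(if k = j then b else 0) \<in> homog mset (add_mset k {#i#})"
      by (simp add: b_def tsubmodule_zero add_mset_commute[of j i] commutator_gen_homog_mset)
  qed
  finally have "- \<eta> a \<in> homog mset (add_mset i M)" by (simp add: tsubmodule_uminus)
  then have kill: "?f (- \<eta> a) = 0"
    by (rule weight_map_other) (use ij in simp)
  have "commutator a (gen j) \<in> homog mset (add_mset j M)"
    using homog_commutator[OF _ a(3) gen_homog_mset[of j]] by simp
  then have keep: "?f (commutator a (gen j)) = left_normed w"
    using v_ne invol
    by (simp add: weight_map_same letter_map_commutator a_def w left_normed_Cons comp_def)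
      (simp add: \<pi>_def)
  have "Phi ?f (der_bracket \<theta> \<eta>) = single_der j (left_normed w)"
  proof (rule Phi_eqI)
    fix k
    \<comment> \<open>Since \<open>\<theta>\<close> kills \<open>x_j\<close>, only the letter
      \<open>x_i\<close> of \<open>b\<close> is hit.\<close>
    have "\<theta> b = commutator a (gen j)"
      using ij by (simp add: b_def derivation_commutator[OF D(1)] gens)
    then show "?f (der_bracket \<theta> \<eta> (gen k)) = single_der j (left_normed w) (gen k)"
      using ij kill keep schur_zero[OF f]
      by (simp add: der_bracket_def gens derivation_zero[OF D(1)] derivation_zero[OF D(2)] single_der_gen)
  qed (simp add: is_derivation_single_der)
  then show "single_der j (left_normed w) \<in> S"
    using closed_Phi[OF _ f bracket] \<open>2 \<le> q\<close> by simp
qed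

lemma Der_star_subset_closed:
  assumes "\<And>j. \<exists>s t. s \<noteq> t \<and> single_der j (commutator (gen s) (gen t)) \<in> S"
  shows "Der_star \<subseteq> S"
proof
  fix x :: "('n, 'k) tensor \<Rightarrow> ('n, 'k) tensor"
  assume x: "x \<in> Der_star"
  \<comment> \<open>The given brackets already involve two different letters, so a letter other than
    \<open>j\<close> exists.\<close>
  have other: "\<exists>i. i \<noteq> j" for j :: 'n
  proof -
    obtain s t :: 'n where "s \<noteq> t" using assms by blast
    then show ?thesis by (cases "s = j") auto
  qed
  have sub: "Der q \<subseteq> S" if "2 \<le> q" for q
    using that
  proof (induction rule: dec_induct)
    case base
    show ?case using assms by (rule Der_2_subset_closed)
  next
    case (step q)
    then show ?case
      using Der_Suc_subset_closed[OF other _ Der_2_subset_closed[OF assms]] by blast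
  qed
  from x show "x \<in> S"
  proof (induction rule: Der_star_induct)
    case zero show "0 \<in> S" by (rule closed_zero)
  next
    case (comp q x) then show ?case using sub by blast
  next
    case (add x y) then show "x + y \<in> S" by (intro closed_add)
  qed
qed

end

lemma hull_eq_Der_star:
  fixes v :: "'n::{finite, linorder} \<Rightarrow> (('n, 'k::{comm_ring, comm_monoid_mult}) tensor \<Rightarrow> ('n, 'k) tensor)"
  assumes "(\<forall>i. \<exists>j. j \<noteq> i \<and> v i = chi i j) \<or>
    (\<forall>i. \<exists>s t. s < t \<and> i \<noteq> s \<and> i \<noteq> t \<and> v i = theta i s t)"
  shows "schur_lie_subalgebra hull (range v) = Der_star"
proof (rule hull_unique)
  \<comment> \<open>Both kinds of families meet the same condition: at every generator, a bracket of
    two different generators, whether or not \<open>j\<close> is one of them.\<close>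
  have v: "\<exists>s t. s \<noteq> t \<and> v j = single_der j (commutator (gen s) (gen t))" for j
    using assms
  proof
    assume "\<forall>i. \<exists>k. k \<noteq> i \<and> v i = chi i k"
    then obtain k where "k \<noteq> j" "v j = chi j k" by blast
    then show ?thesis by (intro exI[of _ j] exI[of _ k]) (simp add: chi_eq)
  next
    assume "\<forall>i. \<exists>s t. s < t \<and> i \<noteq> s \<and> i \<noteq> t \<and> v i = theta i s t"
    then obtain s t where "s < t" "v j = theta j s t" by blast
    then show ?thesis by (intro exI[of _ s] exI[of _ t]) (simp add: theta_eq)
  qed
  show "schur_lie_subalgebra (Der_star :: (('n, 'k) tensor \<Rightarrow> ('n, 'k) tensor) set)"
    by (rule schur_lie_subalgebra_Der_star)
  show "range v \<subseteq> Der_star"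
  proof (rule image_subsetI)
    fix j
    obtain s t where "v j = single_der j (commutator (gen s) (gen t))" using v by blast
    then show "v j \<in> Der_star"
      using Der_star_incl[OF order_refl single_der_Der[OF commutator_gen_comp]] by simp
  qed
  show "Der_star \<subseteq> S" if "range v \<subseteq> S" "schur_lie_subalgebra S" for S
  proof (rule Der_star_subset_closed[OF that(2)])
    fix j
    obtain s t where st: "s \<noteq> t" "v j = single_der j (commutator (gen s) (gen t))" using v by blast
    moreover have "v j \<in> S" using that(1) by blast
    ultimately have "s \<noteq> t \<and> single_der j (commutator (gen s) (gen t)) \<in> S" by simp
    then show "\<exists>s t. s \<noteq> t \<and> single_der j (commutator (gen s) (gen t)) \<in> S" by (intro exI)
  qed
qed

lemma schur_derivation_unique:
  fixes f :: "('n, 'k::{comm_ring, comm_monoid_mult}) tensor \<Rightarrow> ('n, 'k) tensor"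
  assumes "f \<in> schur_carrier q" "\<theta> \<in> Der q"
  shows "\<exists>!D. is_derivation D \<and> (\<forall>i. D (gen i) = f (\<theta> (gen i)))"
proof (rule ex1I[of _ "Phi f \<theta>"])
  show "is_derivation (Phi f \<theta>) \<and> (\<forall>i. Phi f \<theta> (gen i) = f (\<theta> (gen i)))"
    using assms by (simp add: is_derivation_Phi Phi_gen)
next
  fix D assume "is_derivation D \<and> (\<forall>i. D (gen i) = f (\<theta> (gen i)))"
  then have "Phi f \<theta> = D" by (intro Phi_eqI) auto
  then show "D = Phi f \<theta>" ..
qed

theorem theorem6p9:
  shows
    "schur_operad_acts_on
       (UNIV :: ('n::{finite, linorder}, 'k::{comm_ring, comm_monoid_mult}) tensor set)
       UNIV tensor_power tscale (\<lambda>(f :: ('n, 'k) tensor \<Rightarrow> ('n, 'k) tensor) a. f a) \<and>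
     (\<forall>q\<ge>1. free_lie_comp q \<subseteq> (tensor_power q :: ('n, 'k) tensor set)) \<and>
     schur_operad_acts_on (free_lie :: ('n, 'k) tensor set)
       {1..} free_lie_comp tscale (\<lambda>(f :: ('n, 'k) tensor \<Rightarrow> ('n, 'k) tensor) a. f a) \<and>
     (\<forall>q\<ge>1. \<forall>f\<in>carrier (Schur q). \<forall>\<theta>\<in>Der q.
        \<exists>!D :: ('n, 'k) tensor \<Rightarrow> ('n, 'k) tensor.
          is_derivation D \<and> (\<forall>i. D (gen i) = f (\<theta> (gen i)))) \<and>
     schur_operad_acts_on (Der_triangle :: (('n, 'k) tensor \<Rightarrow> ('n, 'k) tensor) set)
       {1..} Der der_scale (Phi :: (('n, 'k) tensor \<Rightarrow> ('n, 'k) tensor) \<Rightarrow> _) \<and>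
     schur_operad_acts_on (Der_star :: (('n, 'k) tensor \<Rightarrow> ('n, 'k) tensor) set)
       {2..} Der der_scale (Phi :: (('n, 'k) tensor \<Rightarrow> ('n, 'k) tensor) \<Rightarrow> _) \<and>
     (\<forall>v :: 'n \<Rightarrow> (('n, 'k) tensor \<Rightarrow> ('n, 'k) tensor).
        (\<forall>i. v i \<in> M_tilde) \<and>
        ((\<forall>i. \<exists>j. j \<noteq> i \<and> v i = chi i j) \<or>
         (\<forall>i. \<exists>s t. s < t \<and> i \<noteq> s \<and> i \<noteq> t \<and> v i = theta i s t)) \<longrightarrow>
        schur_lie_subalgebra hull (range v) = Der_star)"
proof (intro conjI allI impI ballI)
  fix f \<theta> :: "('n, 'k) tensor \<Rightarrow> ('n, 'k) tensor" and q
  assume "f \<in> carrier (Schur q)" "\<theta> \<in> Der q"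
  then show "\<exists>!D. is_derivation D \<and> (\<forall>i. D (gen i) = f (\<theta> (gen i)))"
    by (simp add: schur_derivation_unique)
next
  fix v :: "'n \<Rightarrow> (('n, 'k) tensor \<Rightarrow> ('n, 'k) tensor)"
  assume "(\<forall>i. v i \<in> M_tilde) \<and>
    ((\<forall>i. \<exists>j. j \<noteq> i \<and> v i = chi i j) \<or>
     (\<forall>i. \<exists>s t. s < t \<and> i \<noteq> s \<and> i \<noteq> t \<and> v i = theta i s t))"
  then show "schur_lie_subalgebra hull (range v) = Der_star"
    by (intro hull_eq_Der_star) blast
qed (rule acts_on_tensor_algebra acts_on_free_lie free_lie_comp_tensor_power
  acts_on_Der[of "{1..}", folded Der_triangle_def] acts_on_Der[of "{2..}", folded Der_star_def])+

end
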